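(* There exist an algorithm and an absolute constant $C>0$ with the following property. For all integers $n\ge 2$, $q\ge 2$ and every probability distribution $\mu$ on $[q]^n$, the algorithm, interacting in rounds with a conditional-marginal oracle for $\mu$, outputs a random vector whose law is exactly $\mu$; the expected total number of oracle queries it makes is at most $Cn$; and the expected number of rounds is at most $$C\, n^{2/3}\cdot \min\{\log^{2/3} n\cdot \log q,\; q^{1/3}\log^{1/3} q\}.$$
   Context: $[n]=\{1,\dots,n\}$. Let $X=(X_1,\dots,X_n)\sim\mu$. A conditional-marginal oracle for $\mu$ answers a query $(i,S,\sigma_S)$, with $i\in[n]$, $S\subseteq[n]$, $\sigma_S\in[q]^S$, by returning the whole vector $\big(\mathbb P_{X\sim\mu}[X_i=x\mid X_S=\sigma_S]\big)_{x\in[q]}$. The algorithm interacts with the oracle in rounds: in each round it submits a finite set of queries, chosen as a function of its internal randomness and of all answers received in previous rounds, and receives all of their answers simultaneously. The number of rounds is the number of such interactions before the algorithm produces its output. *)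

theory Defs
  imports "HOL-Probability.Probability"
begin

text \<open>Queries (i, S, sigma_S); only the values of sigma on S matter.
  Answers are vectors indexed by the value x.\<close>
type_synonym query = "nat \<times> nat set \<times> (nat \<Rightarrow> nat)"
type_synonym answer = "nat \<Rightarrow> real"

text \<open>Transcript: for each completed round, the oracle answers to the
  queries of that round (a partial map whose domain is the round's query set).\<close>
type_synonym transcript = "(query \<Rightarrow> answer option) list"

text \<open>A round-based randomized oracle algorithm: given n, q, its internal random
  bits and the transcript of all previous rounds, it either submits the next
  round's set of queries (Inl) or outputs a vector (Inr).\<close>
type_synonym algorithm =
  "nat \<Rightarrow> nat \<Rightarrow> (nat \<Rightarrow> bool) \<Rightarrow> transcript \<Rightarrow> query set + (nat \<Rightarrow> nat)"

definition coins :: "(nat \<Rightarrow> bool) measure" where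
  "coins = PiM UNIV (\<lambda>_::nat. measure_pmf (bernoulli_pmf (1/2)))"

text \<open>The conditional-marginal oracle of mu (answer vector is 0 if the
  conditioning event has probability 0).\<close>
definition cond_marg :: "(nat \<Rightarrow> nat) pmf \<Rightarrow> query \<Rightarrow> answer" where
  "cond_marg \<mu> Q = (case Q of (i, S, \<sigma>) \<Rightarrow> (\<lambda>x.
      measure_pmf.prob \<mu> {y. y i = x \<and> (\<forall>j\<in>S. y j = \<sigma> j)}
      / measure_pmf.prob \<mu> {y. \<forall>j\<in>S. y j = \<sigma> j}))"

fun transcript_after ::
  "algorithm \<Rightarrow> nat \<Rightarrow> nat \<Rightarrow> (query \<Rightarrow> answer) \<Rightarrow> (nat \<Rightarrow> bool) \<Rightarrow> nat \<Rightarrow> transcript" where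
  "transcript_after A n q orc \<omega> 0 = []"
| "transcript_after A n q orc \<omega> (Suc k) =
     (let h = transcript_after A n q orc \<omega> k in
      case A n q \<omega> h of
        Inl Qs \<Rightarrow> h @ [(\<lambda>Q. if Q \<in> Qs then Some (orc Q) else None)]
      | Inr _ \<Rightarrow> h)"

definition halted :: "algorithm \<Rightarrow> nat \<Rightarrow> nat \<Rightarrow> (query \<Rightarrow> answer) \<Rightarrow> (nat \<Rightarrow> bool) \<Rightarrow> nat \<Rightarrow> bool" where
  "halted A n q orc \<omega> k = (case A n q \<omega> (transcript_after A n q orc \<omega> k) of Inl _ \<Rightarrow> False | Inr _ \<Rightarrow> True)"

definition num_rounds :: "algorithm \<Rightarrow> nat \<Rightarrow> nat \<Rightarrow> (query \<Rightarrow> answer) \<Rightarrow> (nat \<Rightarrow> bool) \<Rightarrow> ennreal" where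
  "num_rounds A n q orc \<omega> =
     (if \<exists>k. halted A n q orc \<omega> k then of_nat (LEAST k. halted A n q orc \<omega> k) else \<infinity>)"

definition alg_output :: "algorithm \<Rightarrow> nat \<Rightarrow> nat \<Rightarrow> (query \<Rightarrow> answer) \<Rightarrow> (nat \<Rightarrow> bool) \<Rightarrow> (nat \<Rightarrow> nat) option" where
  "alg_output A n q orc \<omega> =
     (if \<exists>k. halted A n q orc \<omega> k
      then Some (case_sum (\<lambda>_. undefined) id (A n q \<omega> (transcript_after A n q orc \<omega> (LEAST k. halted A n q orc \<omega> k))))
      else None)"

definition qcount :: "query set \<Rightarrow> ennreal" where
  "qcount Qs = (if finite Qs then of_nat (card Qs) else \<infinity>)"

definition num_queries :: "algorithm \<Rightarrow> nat \<Rightarrow> nat \<Rightarrow> (query \<Rightarrow> answer) \<Rightarrow> (nat \<Rightarrow> bool) \<Rightarrow> ennreal" where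
  "num_queries A n q orc \<omega> =
     (\<Sum>k. (case A n q \<omega> (transcript_after A n q orc \<omega> k) of Inl Qs \<Rightarrow> qcount Qs | Inr _ \<Rightarrow> 0))"

end

theory Submission
  imports Defs
begin

text \<open>Reveal the coordinates in a uniformly random order \<open>\<rho>\<close>, in blocks of length
  \<open>L \<approx> (n / ln q) powr (1/3)\<close>. One round asks for the marginals of all coordinates of the current
  block given only the coordinates before the block, and guesses the block independently from
  these laws. A second round asks, for every coordinate of the block, for its marginal given all earlier
  coordinates, on the assumption that the guesses are right; each guess is kept or resampled according
  to a maximal coupling of the two laws. Everything up to and including the first resampled coordinate
  is final and exactly distributed; the rest of the block is verified again in the next round. So the number
  of rounds is at most the number of mistakes plus twice the number of blocks.

  The probability of a mistake is the total variation distance of the guessed and the true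
  conditional law, which is bounded by \<open>\<epsilon>\<close> plus \<open>1/\<epsilon>\<close> times their relative entropy. In expectation the relative
  entropy is a difference of conditional entropies, and in a random order the
  conditional entropy of the next coordinate decreases with the position, so the differences telescope to at most
  \<open>L * ln q\<close> over the whole run. With \<open>\<epsilon> = 1/L\<close> the expected number of rounds is
  \<open>O(n/L + L\<^sup>2 * ln q) = O(n powr (2/3) * (ln q) powr (1/3))\<close>, and each round asks at most \<open>L\<close> queries.\<close>

section \<open>Sampling from coin flips\<close>

definition binary_value :: "(nat \<Rightarrow> bool) \<Rightarrow> real" where
  "binary_value \<omega> = (\<Sum>k. of_bool (\<omega> k) * (1/2) ^ Suc k)"

lemma summable_binary_value: "summable (\<lambda>k. of_bool (\<omega> k) * (1/2::real) ^ Suc k)"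
proof (rule summable_comparison_test')
  show "summable (\<lambda>k. (1/2::real) ^ Suc k)"
    by (rule sums_summable[OF power_half_series])
qed auto

lemma binary_value_nonneg: "0 \<le> binary_value \<omega>"
  unfolding binary_value_def by (intro suminf_nonneg summable_binary_value) auto

lemma binary_value_le_1: "binary_value \<omega> \<le> 1"
proof -
  have s: "(\<lambda>k. (1/2::real) ^ Suc k) sums 1"
    by (rule power_half_series)
  have "binary_value \<omega> \<le> (\<Sum>k. (1/2::real) ^ Suc k)"
    unfolding binary_value_def
    by (intro suminf_le summable_binary_value sums_summable[OF s]) auto
  then show ?thesis using sums_unique[OF s] by simp
qed

lemma binary_value_case_nat:
  "binary_value (case_nat b \<omega>) = (of_bool b + binary_value \<omega>) / 2"
proof -
  let ?f = "\<lambda>k. of_bool (case_nat b \<omega> k) * (1/2::real) ^ Suc k"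
  have "binary_value (case_nat b \<omega>) = (\<Sum>k. ?f (Suc k)) + ?f 0"
    unfolding binary_value_def
    using suminf_split_head[OF summable_binary_value[of "case_nat b \<omega>"]] by linarith
  also have "(\<Sum>k. ?f (Suc k)) = (\<Sum>k. (1/2) * (of_bool (\<omega> k) * (1/2::real) ^ Suc k))"
    by (simp add: mult_ac)
  also have "\<dots> = (1/2) * binary_value \<omega>"
    unfolding binary_value_def by (rule suminf_mult[OF summable_binary_value])
  finally show ?thesis by simp
qed

lemma prob_space_coins: "prob_space coins"
  unfolding coins_def by (intro prob_space_PiM measure_pmf.prob_space_axioms)

interpretation coins: prob_space coins by (rule prob_space_coins)

lemma space_coins [simp]: "space coins = UNIV"
  by (simp add: coins_def space_PiM)

lemma measurable_coin [measurable]: "(\<lambda>\<omega>. \<omega> i) \<in> coins \<rightarrow>\<^sub>M count_space UNIV"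
  unfolding coins_def
  by (rule measurable_cong_sets[THEN equalityD1, THEN subsetD, rotated 2, OF measurable_component_singleton[of i UNIV]]) auto

lemma measurable_into_coins:
  "(\<And>i. (\<lambda>x. f x i) \<in> M \<rightarrow>\<^sub>M count_space UNIV) \<Longrightarrow> f \<in> M \<rightarrow>\<^sub>M coins"
  unfolding coins_def
  by (rule measurable_PiM_single') (auto simp: space_PiM)

lemma binary_value_measurable [measurable]: "binary_value \<in> borel_measurable coins"
  unfolding binary_value_def[abs_def] by measurable

text \<open>The functional equation of \<open>binary_cdf\<close> rests on this self-similarity of
  the product measure, an instance of \<open>PiM_iter\<close>.\<close>

lemma coins_case_nat:
  "distr (measure_pmf (bernoulli_pmf (1/2)) \<Otimes>\<^sub>M coins) coins (\<lambda>(b, \<omega>). case_nat b \<omega>) = coins"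
proof -
  interpret sequence_space "measure_pmf (bernoulli_pmf (1/2))" ..
  show ?thesis using PiM_iter unfolding coins_def .
qed

definition binary_cdf :: "real \<Rightarrow> real" where
  "binary_cdf t = coins.prob {\<omega>. binary_value \<omega> \<le> t}"

text \<open>Split on the first bit \<open>b\<close>, which is fair and independent of the others: by
  \<open>binary_value_case_nat\<close> the value is at most \<open>t\<close> iff the value of the
  remaining bits is at most \<open>2 * t - of_bool b\<close>.\<close>

lemma binary_cdf_rec: "binary_cdf t = (binary_cdf (2 * t) + binary_cdf (2 * t - 1)) / 2"
proof -
  let ?B = "measure_pmf (bernoulli_pmf (1/2))"
  have A: "{\<omega>. binary_value \<omega> \<le> t} \<in> sets coins" for t
  proof -
    have "{\<omega> \<in> space coins. binary_value \<omega> \<le> t} \<in> sets coins" by measurable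
    then show ?thesis by simp
  qed
  have meas [measurable]: "(\<lambda>(b, \<omega>). case_nat b \<omega>) \<in> ?B \<Otimes>\<^sub>M coins \<rightarrow>\<^sub>M coins"
  proof (rule measurable_into_coins)
    fix i :: nat
    show "(\<lambda>x. (case x of (b, \<omega>) \<Rightarrow> case_nat b \<omega>) i) \<in> ?B \<Otimes>\<^sub>M coins \<rightarrow>\<^sub>M count_space UNIV"
    proof (cases i)
      case 0
      have "fst \<in> ?B \<Otimes>\<^sub>M coins \<rightarrow>\<^sub>M ?B" by measurable
      then have "fst \<in> ?B \<Otimes>\<^sub>M coins \<rightarrow>\<^sub>M count_space UNIV"
        by (simp cong: measurable_cong_sets)
      then show ?thesis using 0 by (simp add: case_prod_beta')
    next
      case (Suc k) then show ?thesis by (simp add: case_prod_beta')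
    qed
  qed
  interpret P: pair_sigma_finite ?B coins
    by (intro pair_sigma_finite.intro measure_pmf.sigma_finite_measure_axioms coins.sigma_finite_measure_axioms)
  have "ennreal (binary_cdf t) = emeasure coins {\<omega>. binary_value \<omega> \<le> t}"
    by (simp add: binary_cdf_def coins.emeasure_eq_measure)
  also have "\<dots> = (\<integral>\<^sup>+ \<omega>. indicator {\<omega>. binary_value \<omega> \<le> t} \<omega> \<partial>coins)"
    using A by simp
  also have "\<dots> = (\<integral>\<^sup>+ x. indicator {\<omega>. binary_value \<omega> \<le> t} (case x of (b, \<omega>) \<Rightarrow> case_nat b \<omega>) \<partial>(?B \<Otimes>\<^sub>M coins))"
    by (subst coins_case_nat[symmetric], subst nn_integral_distr[OF meas]) (use A in auto)
  also have "\<dots> = (\<integral>\<^sup>+ b. \<integral>\<^sup>+ \<omega>. indicator {\<omega>. binary_value \<omega> \<le> t} (case_nat b \<omega>) \<partial>coins \<partial>?B)"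
  proof -
    have "(\<lambda>x. indicator {\<omega>. binary_value \<omega> \<le> t} (case x of (b, \<omega>) \<Rightarrow> case_nat b \<omega>) :: ennreal)
        \<in> borel_measurable (?B \<Otimes>\<^sub>M coins)"
      using meas A by measurable
    from coins.nn_integral_fst[OF this] show ?thesis by simp
  qed
  also have "\<dots> = (\<integral>\<^sup>+ b. emeasure coins {\<omega>. binary_value \<omega> \<le> 2 * t - of_bool b} \<partial>?B)"
  proof (rule nn_integral_cong)
    fix b
    have "indicator {\<omega>. binary_value \<omega> \<le> t} (case_nat b \<omega>)
       = (indicator {\<omega>. binary_value \<omega> \<le> 2 * t - of_bool b} \<omega> :: ennreal)" for \<omega>
      by (auto simp: indicator_def binary_value_case_nat field_simps)
    then show "(\<integral>\<^sup>+ \<omega>. indicator {\<omega>. binary_value \<omega> \<le> t} (case_nat b \<omega>) \<partial>coins)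
        = emeasure coins {\<omega>. binary_value \<omega> \<le> 2 * t - of_bool b}"
      using A by simp
  qed
  also have "\<dots> = ennreal ((binary_cdf (2 * t) + binary_cdf (2 * t - 1)) / 2)"
  proof -
    have half: "inverse 2 * ennreal a = ennreal (a / 2)" if "a \<ge> 0" for a
      by (metis divide_ennreal_def ennreal_divide_numeral mult.commute that)
    have nonneg: "binary_cdf t \<ge> 0" for t by (simp add: binary_cdf_def)
    have e: "emeasure coins {\<omega>. binary_value \<omega> \<le> t} = ennreal (binary_cdf t)" for t
      by (simp add: binary_cdf_def coins.emeasure_eq_measure)
    show ?thesis
      unfolding e by (simp add: half nonneg add_divide_distrib mult.commute)
  qed
  finally show ?thesis
    by (simp add: binary_cdf_def)
qed

text \<open>By self-similarity, the distance of the distribution function from the uniform one at \<open>t\<close> is half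
  of that at \<open>2 * t\<close> or at \<open>2 * t - 1\<close>.\<close>

lemma binary_cdf_approx: "\<bar>binary_cdf t - max 0 (min 1 t)\<bar> \<le> (1/2) ^ k"
proof (induction k arbitrary: t)
  case 0
  have "0 \<le> binary_cdf t" "binary_cdf t \<le> 1" by (auto simp: binary_cdf_def)
  then show ?case by (auto simp: max_def min_def)
next
  case (Suc k)
  have neg: "binary_cdf s = 0" if "s < 0" for s
  proof -
    have "\<not> binary_value \<omega> \<le> s" for \<omega> using binary_value_nonneg[of \<omega>] that by linarith
    then show ?thesis by (simp add: binary_cdf_def)
  qed
  have ge1: "binary_cdf s = 1" if "1 \<le> s" for s
  proof -
    have "binary_value \<omega> \<le> s" for \<omega> using binary_value_le_1[of \<omega>] that by linarith
    then show ?thesis using coins.prob_space by (simp add: binary_cdf_def)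
  qed
  \<comment> \<open>In either half only one branch of the recursion carries an error: for
    \<open>t < 1/2\<close> the branch at \<open>2 * t - 1\<close> is exactly 0, otherwise the branch
    at \<open>2 * t\<close> is exactly 1.\<close>
  show ?case
  proof (cases "t < 1/2")
    case True
    then have "max 0 (min 1 t) = max 0 (min 1 (2 * t)) / 2" "binary_cdf t = binary_cdf (2 * t) / 2"
      using neg[of "2 * t - 1"] binary_cdf_rec[of t] by (auto simp: max_def min_def)
    then have "binary_cdf t - max 0 (min 1 t) = (binary_cdf (2 * t) - max 0 (min 1 (2 * t))) / 2"
      by (simp only: diff_divide_distrib)
    then show ?thesis using Suc[of "2 * t"] by (simp only: abs_divide power_Suc) simp
  next
    case False
    then have "max 0 (min 1 t) = (1 + max 0 (min 1 (2 * t - 1))) / 2"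
        "binary_cdf t = (1 + binary_cdf (2 * t - 1)) / 2"
      using ge1[of "2 * t"] binary_cdf_rec[of t] by (auto simp: max_def min_def)
    then have "binary_cdf t - max 0 (min 1 t) = (binary_cdf (2 * t - 1) - max 0 (min 1 (2 * t - 1))) / 2"
      by (simp add: diff_divide_distrib add_divide_distrib)
    then show ?thesis using Suc[of "2 * t - 1"] by (simp only: abs_divide power_Suc) simp
  qed
qed

lemma binary_cdf_eq: "binary_cdf t = max 0 (min 1 t)"
proof -
  have "(\<lambda>k. (1/2::real) ^ k) \<longlonglongrightarrow> 0" by (rule LIMSEQ_realpow_zero) auto
  then have "\<bar>binary_cdf t - max 0 (min 1 t)\<bar> \<le> 0"
    by (rule LIMSEQ_le_const) (use binary_cdf_approx in auto)
  then show ?thesis by simp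
qed

text \<open>Both sides have the same distribution function. The uniform law is written on the open
  unit interval because this is the measure that the quantile function of
  \<open>cdf_distribution\<close> pushes forward to a given law.\<close>

lemma distr_binary_value:
  "distr coins borel binary_value = distr (restrict_space lborel {0<..<1::real}) borel (\<lambda>x. x)"
proof (intro cdf_unique ext)
  let ?\<Omega> = "restrict_space lborel {0<..<1}::real measure"
  have id[measurable]: "(\<lambda>x. x) \<in> borel_measurable ?\<Omega>"
    by (intro measurable_restrict_space1) simp
  interpret \<Omega>: prob_space ?\<Omega>
    by (auto simp add: emeasure_restrict_space space_restrict_space intro!: prob_spaceI)
  show "real_distribution (distr coins borel binary_value)" by (intro coins.real_distribution_distr) measurable
  show "real_distribution (distr ?\<Omega> borel (\<lambda>x. x))" by (intro \<Omega>.real_distribution_distr) measurable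
  fix t :: real
  have 1: "cdf (distr coins borel binary_value) t = max 0 (min 1 t)"
    unfolding cdf_def binary_cdf_eq[symmetric] binary_cdf_def
    by (subst measure_distr) (auto simp: vimage_def)
  have "emeasure (distr ?\<Omega> borel (\<lambda>x. x)) {..t} = emeasure ?\<Omega> ({..t} \<inter> {0<..<1})"
    by (subst emeasure_distr) (auto simp: space_restrict_space)
  also have "\<dots> = emeasure lborel ({..t} \<inter> {0<..<1::real})"
    by (subst emeasure_restrict_space) auto
  also have "{..t} \<inter> {0<..<1::real} = (if t < 1 then {0<..t} else {0<..<1})"
    by auto
  also have "emeasure lborel \<dots> = ennreal (max 0 (min 1 t))"
    by (auto simp: max_def min_def not_le)
  finally have 2: "cdf (distr ?\<Omega> borel (\<lambda>x. x)) t = max 0 (min 1 t)"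
    by (cases "0 \<le> min 1 t") (auto simp: cdf_def measure_def max_def ennreal_neg)
  show "cdf (distr coins borel binary_value) t = cdf (distr ?\<Omega> borel (\<lambda>x. x)) t"
    using 1 2 by simp
qed

section \<open>Inverse transform sampling of discrete laws\<close>

lemma ex_nat_sampler:
  fixes p :: "nat pmf"
  shows "\<exists>f. f \<in> coins \<rightarrow>\<^sub>M count_space UNIV \<and> distr coins (count_space UNIV) f = measure_pmf p"
proof -
  let ?\<Omega> = "restrict_space lborel {0<..<1}::real measure"
  define M where "M = distr (measure_pmf p) borel real"
  interpret M: real_distribution M
    unfolding M_def by (intro prob_space.real_distribution_distr[OF measure_pmf.prob_space_axioms]) simp
  interpret C: cdf_distribution M ..
  \<comment> \<open>The quantile function \<open>C.I\<close> matters only on the open unit interval.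
    Extending it by 0 gives a Borel function on the whole line, which composes with
    \<open>binary_value\<close> even at the values 0 and 1.\<close>
  define J where "J = (\<lambda>x. indicator {0<..<1} x *\<^sub>R C.I x)"
  have id[measurable]: "(\<lambda>x. x) \<in> borel_measurable ?\<Omega>"
    by (intro measurable_restrict_space1) simp
  have "C.I \<in> borel_measurable (restrict_space borel {0<..<1})"
    using C.measurable_CI by (simp add: sets_restrict_space cong: measurable_cong_sets)
  then have J [measurable]: "J \<in> borel_measurable borel"
    unfolding J_def by (subst (asm) borel_measurable_restrict_space_iff) auto
  have "distr coins borel (J \<circ> binary_value) = distr (distr coins borel binary_value) borel J"
    by (subst distr_distr) auto
  also have "\<dots> = distr ?\<Omega> borel (J \<circ> (\<lambda>x. x))"
    unfolding distr_binary_value by (subst distr_distr) auto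
  also have "\<dots> = distr ?\<Omega> borel C.I"
    by (rule distr_cong) (auto simp: J_def space_restrict_space)
  also have "\<dots> = M" by (rule C.distr_I_eq_M)
  finally have J_law: "distr coins borel (J \<circ> binary_value) = M" .
  \<comment> \<open>A left inverse of \<open>real\<close>, bringing the sample back to the
    naturals.\<close>
  let ?g = "\<lambda>x::real. nat \<lfloor>x\<rfloor>"
  have g [measurable]: "?g \<in> borel \<rightarrow>\<^sub>M count_space UNIV" by measurable
  have m: "J \<circ> binary_value \<in> coins \<rightarrow>\<^sub>M borel" by measurable
  have "distr coins (count_space UNIV) (?g \<circ> (J \<circ> binary_value)) = distr M (count_space UNIV) ?g"
    by (subst J_law[symmetric], subst distr_distr[OF g m]) simp
  also have "\<dots> = distr (measure_pmf p) (count_space UNIV) (?g \<circ> real)"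
    unfolding M_def by (subst distr_distr) auto
  also have "?g \<circ> real = (\<lambda>x. x)" by auto
  also have "distr (measure_pmf p) (count_space UNIV) (\<lambda>x. x) = measure_pmf p"
    by (rule distr_id2) simp
  finally show ?thesis using m g by (intro exI[of _ "?g \<circ> (J \<circ> binary_value)"]) (auto simp: comp_def)
qed

lemma ex_sampler:
  fixes p :: "'a::countable pmf"
  shows "\<exists>f. f \<in> coins \<rightarrow>\<^sub>M count_space UNIV \<and> distr coins (count_space UNIV) f = measure_pmf p"
proof -
  obtain f where f [measurable]: "f \<in> coins \<rightarrow>\<^sub>M count_space UNIV"
    and d: "distr coins (count_space UNIV) f = measure_pmf (map_pmf to_nat p)"
    using ex_nat_sampler by blast
  have "distr coins (count_space UNIV) ((from_nat :: nat \<Rightarrow> 'a) \<circ> f) = distr (distr coins (count_space UNIV) f) (count_space UNIV) from_nat"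
    by (subst distr_distr) auto
  also have "\<dots> = measure_pmf (map_pmf (from_nat \<circ> to_nat) p)"
    unfolding d by (simp add: map_pmf_rep_eq[symmetric] map_pmf_comp comp_def)
  also have "map_pmf (from_nat \<circ> to_nat) p = p" by (simp add: comp_def)
  finally show ?thesis by (intro exI[of _ "from_nat \<circ> f"]) (auto simp: comp_def)
qed

text \<open>An algorithm here is an arbitrary function of its coins, so existence is enough and one
  sampler per law may be fixed by choice.\<close>

definition sampler :: "'a::countable pmf \<Rightarrow> (nat \<Rightarrow> bool) \<Rightarrow> 'a" where
  "sampler p = (SOME f. f \<in> coins \<rightarrow>\<^sub>M count_space UNIV \<and> distr coins (count_space UNIV) f = measure_pmf p)"

lemma sampler_measurable [measurable]: "sampler p \<in> coins \<rightarrow>\<^sub>M count_space UNIV"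
  and distr_sampler: "distr coins (count_space UNIV) (sampler p) = measure_pmf p"
  unfolding sampler_def using someI_ex[OF ex_sampler[of p]] by auto

section \<open>Disjoint coin blocks as independent sources of randomness\<close>

definition coin_block :: "nat \<Rightarrow> (nat \<Rightarrow> bool) \<Rightarrow> (nat \<Rightarrow> bool)" where
  "coin_block j \<omega> = (\<lambda>k. \<omega> (prod_encode (j, k)))"

lemma coin_block_measurable [measurable]: "coin_block j \<in> coins \<rightarrow>\<^sub>M coins"
  unfolding coin_block_def[abs_def] by (rule measurable_into_coins) measurable

lemma distr_coin_block: "distr coins coins (coin_block j) = coins"
proof -
  have "inj (\<lambda>k. prod_encode (j, k))" by (auto simp: inj_on_def)
  from distr_PiM_reindex[of UNIV "\<lambda>_. measure_pmf (bernoulli_pmf (1/2))", OF _ this]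
  show ?thesis unfolding coins_def coin_block_def[abs_def]
    by (simp add: measure_pmf.prob_space_axioms restrict_UNIV)
qed

lemma indep_vars_coins:
  "coins.indep_vars (\<lambda>_. measure_pmf (bernoulli_pmf (1/2))) (\<lambda>i \<omega>. \<omega> i) UNIV"
proof -
  let ?B = "measure_pmf (bernoulli_pmf (1/2))"
  have rv: "(\<lambda>\<omega>. \<omega> i) \<in> coins \<rightarrow>\<^sub>M ?B" for i
    using measurable_coin[of i] by (simp cong: measurable_cong_sets)
  have c: "distr coins ?B (\<lambda>\<omega>. \<omega> i) = ?B" for i :: nat
    unfolding coins_def by (rule distr_PiM_component) (auto simp: measure_pmf.prob_space_axioms)
  have "distr coins (PiM UNIV (\<lambda>_::nat. ?B)) (\<lambda>x. \<lambda>i\<in>UNIV. x i) = coins"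
    unfolding coins_def by (simp add: distr_id2 restrict_UNIV)
  then show ?thesis
    by (subst coins.indep_vars_iff_distr_eq_PiM') (auto simp: rv c, simp add: coins_def)
qed

text \<open>The last clause, that \<open>f\<close> reads only the blocks below \<open>m\<close>,
  stands in for measurability with respect to a smaller sigma-algebra: it keeps block
  \<open>m\<close> fresh for the next draw.\<close>

definition dist_by :: "nat \<Rightarrow> ((nat \<Rightarrow> bool) \<Rightarrow> 'a) \<Rightarrow> 'a pmf \<Rightarrow> bool" where
  "dist_by m f p \<longleftrightarrow> f \<in> coins \<rightarrow>\<^sub>M count_space UNIV \<and> distr coins (count_space UNIV) f = measure_pmf p
     \<and> (\<forall>\<omega> \<omega>'. (\<forall>j<m. coin_block j \<omega> = coin_block j \<omega>') \<longrightarrow> f \<omega> = f \<omega>')"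

lemma dist_by_return: "dist_by m (\<lambda>_. x) (return_pmf x)"
  unfolding dist_by_def
  by (auto simp: return_pmf.rep_eq coins.distr_const)

lemma dist_by_map: "dist_by m f p \<Longrightarrow> dist_by m (\<lambda>\<omega>. g (f \<omega>)) (map_pmf g p)"
proof -
  assume d: "dist_by m f p"
  then have [measurable]: "f \<in> coins \<rightarrow>\<^sub>M count_space UNIV" by (simp add: dist_by_def)
  have "distr coins (count_space UNIV) (g \<circ> f) = distr (distr coins (count_space UNIV) f) (count_space UNIV) g"
    by (subst distr_distr) auto
  moreover have "g \<circ> f \<in> coins \<rightarrow>\<^sub>M count_space UNIV" by measurable
  moreover have "g (f \<omega>) = g (f \<omega>')" if "\<forall>j<m. coin_block j \<omega> = coin_block j \<omega>'" for \<omega> \<omega>'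
    using d that unfolding dist_by_def by metis
  ultimately show ?thesis using d unfolding dist_by_def
    by (simp add: comp_def map_pmf_rep_eq)
qed

lemma pmf_bind_Pair:
  "pmf (bind_pmf p (\<lambda>s. map_pmf (Pair s) (\<kappa> s))) (s, v) = pmf p s * pmf (\<kappa> s) v"
proof -
  have "pmf (map_pmf (Pair s') (\<kappa> s')) (s, v) = indicator {s} s' * pmf (\<kappa> s) v" for s'
  proof (cases "s' = s")
    case True
    then show ?thesis using pmf_map_inj'[of "Pair s" "\<kappa> s" v] by (simp add: inj_on_def)
  next
    case False
    then have "(s, v) \<notin> set_pmf (map_pmf (Pair s') (\<kappa> s'))" by auto
    then show ?thesis using False by (simp add: pmf_eq_0_set_pmf)
  qed
  then show ?thesis by (simp add: pmf_bind measure_pmf_single)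
qed

text \<open>For a fixed value \<open>s\<close> of \<open>f\<close>, the sampler of
  \<open>\<kappa> s\<close> reads only block \<open>m\<close> and is therefore independent of
  \<open>f\<close>. All types being countable, the joint law is determined by these point masses,
  although the law sampled from depends on \<open>f \<omega>\<close>.\<close>

lemma dist_by_bind:
  fixes f :: "(nat \<Rightarrow> bool) \<Rightarrow> 'a::countable" and \<kappa> :: "'a \<Rightarrow> 'b::countable pmf"
  assumes d: "dist_by m f p"
  shows "dist_by (Suc m) (\<lambda>\<omega>. (f \<omega>, sampler (\<kappa> (f \<omega>)) (coin_block m \<omega>))) (bind_pmf p (\<lambda>s. map_pmf (Pair s) (\<kappa> s)))"
proof -
  let ?B = "measure_pmf (bernoulli_pmf (1/2))"
  let ?F = "\<lambda>\<omega>. (f \<omega>, sampler (\<kappa> (f \<omega>)) (coin_block m \<omega>))"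
  have f [measurable]: "f \<in> coins \<rightarrow>\<^sub>M count_space UNIV" using d by (simp add: dist_by_def)
  have F [measurable]: "?F \<in> coins \<rightarrow>\<^sub>M count_space UNIV"
    by (rule measurable_compose_countable[where g=f and f="\<lambda>s \<omega>. (s, sampler (\<kappa> s) (coin_block m \<omega>))"])
      measurable
  define I where "I = {i. fst (prod_decode i) < m}"
  define J where "J = {i. fst (prod_decode i) = m}"
  have ind: "coins.indep_var (PiM I (\<lambda>_. ?B)) (\<lambda>\<omega>. restrict (\<lambda>i. \<omega> i) I) (PiM J (\<lambda>_. ?B)) (\<lambda>\<omega>. restrict (\<lambda>i. \<omega> i) J)"
    by (rule coins.indep_var_restrict[OF indep_vars_coins]) (auto simp: I_def J_def)
  have joint: "coins.prob {\<omega>. f \<omega> = s \<and> sampler (\<kappa> s) (coin_block m \<omega>) = v} = pmf p s * pmf (\<kappa> s) v" for s v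
  proof -
    \<comment> \<open>Filling in arbitrary bits outside the blocks below \<open>m\<close> makes
      \<open>f\<close> a function of the coins in \<open>I\<close> alone; likewise
      \<open>sub\<close> reads block \<open>m\<close> from the coins in \<open>J\<close>.\<close>
    define ext where "ext = (\<lambda>(\<eta>::nat \<Rightarrow> bool) i. if i \<in> I then \<eta> i else False)"
    define sub where "sub = (\<lambda>(\<eta>::nat \<Rightarrow> bool) k. \<eta> (prod_encode (m, k)))"
    have comp: "(\<lambda>\<eta>. \<eta> i) \<in> PiM K (\<lambda>_. ?B) \<rightarrow>\<^sub>M count_space UNIV" if "i \<in> K" for i K
      using measurable_component_singleton[OF that, of "\<lambda>_. ?B"] by (simp cong: measurable_cong_sets)
    have e: "ext \<in> PiM I (\<lambda>_. ?B) \<rightarrow>\<^sub>M coins"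
      unfolding ext_def
    proof (rule measurable_into_coins)
      fix i
      show "(\<lambda>\<eta>. if i \<in> I then \<eta> i else False) \<in> PiM I (\<lambda>_. ?B) \<rightarrow>\<^sub>M count_space UNIV"
        by (cases "i \<in> I") (simp_all add: comp)
    qed
    have s: "sub \<in> PiM J (\<lambda>_. ?B) \<rightarrow>\<^sub>M coins"
      unfolding sub_def by (rule measurable_into_coins) (auto intro!: comp simp: J_def)
    have fe: "f (ext (restrict \<omega> I)) = f \<omega>" for \<omega>
    proof -
      have "\<forall>j<m. coin_block j (ext (restrict \<omega> I)) = coin_block j \<omega>"
        by (auto simp: coin_block_def ext_def I_def)
      then show ?thesis using d unfolding dist_by_def by blast
    qed
    have ss: "sub (restrict \<omega> J) = coin_block m \<omega>" for \<omega>
      by (auto simp: sub_def coin_block_def J_def)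
    have "coins.indep_var (count_space UNIV) (((\<lambda>x. x = s) \<circ> f \<circ> ext) \<circ> (\<lambda>\<omega>. restrict (\<lambda>i. \<omega> i) I))
            (count_space UNIV) (((\<lambda>y. y = v) \<circ> sampler (\<kappa> s) \<circ> sub) \<circ> (\<lambda>\<omega>. restrict (\<lambda>i. \<omega> i) J))"
      by (rule coins.indep_var_compose[OF ind]) (auto intro!: measurable_comp[OF e] measurable_comp[OF s])
    then have "coins.indep_var (count_space UNIV) (\<lambda>\<omega>. f \<omega> = s) (count_space UNIV) (\<lambda>\<omega>. sampler (\<kappa> s) (coin_block m \<omega>) = v)"
      by (simp add: comp_def fe ss)
    from coins.indep_varD[OF this, of "{True}" "{True}"]
    have "coins.prob {\<omega>. f \<omega> = s \<and> sampler (\<kappa> s) (coin_block m \<omega>) = v}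
      = coins.prob (f -` {s}) * coins.prob ((\<lambda>\<omega>. sampler (\<kappa> s) (coin_block m \<omega>)) -` {v})"
      by (simp add: vimage_def)
    also have "coins.prob (f -` {s}) = measure (distr coins (count_space UNIV) f) {s}"
      by (subst measure_distr) auto
    also have "\<dots> = pmf p s" using d by (simp add: dist_by_def pmf.rep_eq)
    also have "coins.prob ((\<lambda>\<omega>. sampler (\<kappa> s) (coin_block m \<omega>)) -` {v})
      = measure (distr (distr coins coins (coin_block m)) (count_space UNIV) (sampler (\<kappa> s))) {v}"
      by (subst distr_distr, simp, simp, subst measure_distr) (auto simp: comp_def vimage_def)
    also have "\<dots> = pmf (\<kappa> s) v" by (simp add: distr_coin_block distr_sampler pmf.rep_eq)
    finally show ?thesis .
  qed
  have "distr coins (count_space UNIV) ?F = measure_pmf (bind_pmf p (\<lambda>s. map_pmf (Pair s) (\<kappa> s)))"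
  proof (rule measure_eqI_countable[of _ UNIV])
    fix a :: "'a \<times> 'b"
    obtain s v where a: "a = (s, v)" by force
    have "emeasure (distr coins (count_space UNIV) ?F) {a} = emeasure coins (?F -` {a})"
      by (subst emeasure_distr) auto
    also have "?F -` {a} = {\<omega>. f \<omega> = s \<and> sampler (\<kappa> s) (coin_block m \<omega>) = v}" by (auto simp: a)
    also have "emeasure coins \<dots> = ennreal (pmf p s * pmf (\<kappa> s) v)"
      by (simp add: coins.emeasure_eq_measure joint)
    also have "\<dots> = emeasure (measure_pmf (bind_pmf p (\<lambda>s. map_pmf (Pair s) (\<kappa> s)))) {a}"
      by (simp add: a emeasure_pmf_single pmf_bind_Pair)
    finally show "emeasure (distr coins (count_space UNIV) ?F) {a}
      = emeasure (measure_pmf (bind_pmf p (\<lambda>s. map_pmf (Pair s) (\<kappa> s)))) {a}" .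
  qed auto
  moreover have "?F \<omega> = ?F \<omega>'" if "\<forall>j<Suc m. coin_block j \<omega> = coin_block j \<omega>'" for \<omega> \<omega>'
  proof -
    have "f \<omega> = f \<omega>'" using d that unfolding dist_by_def by (meson less_SucI)
    then show ?thesis using that by simp
  qed
  ultimately show ?thesis unfolding dist_by_def using F by blast
qed


section \<open>Repairing a guess by maximal coupling\<close>

text \<open>One minus the total variation distance, written as the chance that a guess drawn from
  \<open>r\<close> is kept.\<close>

definition overlap :: "nat pmf \<Rightarrow> nat pmf \<Rightarrow> real" where
  "overlap r p = measure_pmf.expectation r (\<lambda>y. min 1 (pmf p y / pmf r y))"

text \<open>Junk if \<open>overlap r p = 1\<close>, but then a guess drawn from \<open>r\<close> is always kept.\<close>

definition residual :: "nat pmf \<Rightarrow> nat pmf \<Rightarrow> nat pmf" where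
  "residual r p = embed_pmf (\<lambda>x. (pmf p x - min (pmf r x) (pmf p x)) / (1 - overlap r p))"

text \<open>The maximal coupling in kernel form: the guess has already been drawn from
  \<open>r\<close>, so only the conditional law of the other coordinate is left to sample.\<close>

definition repair :: "nat pmf \<Rightarrow> nat pmf \<Rightarrow> nat \<Rightarrow> nat pmf" where
  "repair r p y = bind_pmf (bernoulli_pmf (min 1 (pmf p y / pmf r y)))
     (\<lambda>keep. if keep then return_pmf y else residual r p)"

lemma keep_prob_bounds: "0 \<le> min 1 (pmf p y / pmf r y)" "min 1 (pmf p y / pmf r y) \<le> 1"
  by auto

lemma pmf_mult_keep_prob: "pmf r y * min 1 (pmf p y / pmf r y) = min (pmf r y) (pmf p y)"
proof (cases "pmf r y = 0")
  case False
  then have "pmf r y > 0" using pmf_nonneg[of r y] by linarith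
  then show ?thesis by (auto simp: min_def field_simps)
qed simp

lemma pmf_repair: "pmf (repair r p y) x =
    min 1 (pmf p y / pmf r y) * indicator {y} x + (1 - min 1 (pmf p y / pmf r y)) * pmf (residual r p) x"
  unfolding repair_def pmf_bind using keep_prob_bounds[of p y r]
  by (subst integral_bernoulli_pmf) (auto simp: indicator_def)

locale finite_pmf_pair =
  fixes r p :: "nat pmf" and V :: "nat set"
  assumes finV: "finite V" and rV: "set_pmf r \<subseteq> V" and pV: "set_pmf p \<subseteq> V"
begin

lemma expectation_r: "measure_pmf.expectation r f = (\<Sum>v\<in>V. pmf r v * f v)" for f :: "nat \<Rightarrow> real"
  using integral_measure_pmf_real[of V r f] finV rV by (auto simp: mult.commute)

lemma sum_r: "(\<Sum>v\<in>V. pmf r v) = 1" and sum_p: "(\<Sum>v\<in>V. pmf p v) = 1"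
  using sum_pmf_eq_1[OF finV rV] sum_pmf_eq_1[OF finV pV] by auto

lemma overlap_eq: "overlap r p = (\<Sum>v\<in>V. min (pmf r v) (pmf p v))"
  unfolding overlap_def expectation_r by (simp add: pmf_mult_keep_prob)

lemma overlap_le_1: "overlap r p \<le> 1"
  unfolding overlap_eq sum_r[symmetric] by (rule sum_mono) auto

lemma outside: "v \<notin> V \<Longrightarrow> pmf r v = 0" "v \<notin> V \<Longrightarrow> pmf p v = 0"
  using rV pV by (auto simp: pmf_eq_0_set_pmf)

lemma pmf_residual:
  assumes "overlap r p \<noteq> 1"
  shows "pmf (residual r p) x = (pmf p x - min (pmf r x) (pmf p x)) / (1 - overlap r p)"
  unfolding residual_def
proof (rule pmf_embed_pmf)
  let ?f = "\<lambda>x. (pmf p x - min (pmf r x) (pmf p x)) / (1 - overlap r p)"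
  have pos: "1 - overlap r p > 0" using assms overlap_le_1 by linarith
  show nn: "0 \<le> ?f x" for x using pos by (intro divide_nonneg_pos) auto
  have "(\<integral>\<^sup>+ x. ennreal (?f x) \<partial>count_space UNIV) = (\<Sum>x\<in>V. ennreal (?f x))"
  proof (rule nn_integral_count_space'[OF finV])
    fix x assume "x \<notin> V" then show "ennreal (?f x) = 0" by (simp add: outside)
  qed auto
  also have "\<dots> = ennreal (\<Sum>x\<in>V. ?f x)" by (rule sum_ennreal) (rule nn)
  also have "(\<Sum>x\<in>V. ?f x) = 1"
    using pos by (simp add: sum_divide_distrib[symmetric] sum_subtractf sum_p overlap_eq)
  finally show "(\<integral>\<^sup>+ x. ennreal (?f x) \<partial>count_space UNIV) = 1" by simp
qed

text \<open>Kept guesses contribute the common mass \<open>min (pmf r x) (pmf p x)\<close>; the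
  rejected mass \<open>1 - overlap r p\<close> is spread as \<open>residual\<close> and fills
  exactly the deficit to \<open>pmf p x\<close>.\<close>

lemma bind_repair: "bind_pmf r (repair r p) = p"
proof (rule pmf_eqI)
  fix x
  let ?a = "\<lambda>y. min 1 (pmf p y / pmf r y)"
  have "pmf (bind_pmf r (repair r p)) x
      = (\<Sum>y\<in>V. pmf r y * (?a y * indicator {y} x + (1 - ?a y) * pmf (residual r p) x))"
    by (simp only: pmf_bind expectation_r pmf_repair)
  also have "\<dots> = (\<Sum>y\<in>V. (if y = x then min (pmf r x) (pmf p x) else 0)
      + (pmf r y - min (pmf r y) (pmf p y)) * pmf (residual r p) x)"
  proof (rule sum.cong[OF refl])
    fix y
    have "pmf r y * (?a y * i + (1 - ?a y) * c) = (pmf r y * ?a y) * i + (pmf r y - pmf r y * ?a y) * c" for i c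
      by (simp add: algebra_simps)
    from this[of "indicator {y} x"] show "pmf r y * (?a y * indicator {y} x + (1 - ?a y) * pmf (residual r p) x) =
         (if y = x then min (pmf r x) (pmf p x) else 0) + (pmf r y - min (pmf r y) (pmf p y)) * pmf (residual r p) x"
      by (simp only: pmf_mult_keep_prob) (auto simp: indicator_def)
  qed
  also have "\<dots> = min (pmf r x) (pmf p x) + (1 - overlap r p) * pmf (residual r p) x"
    by (simp add: sum.distrib sum_distrib_right[symmetric] sum_subtractf sum_r overlap_eq finV outside)
  also have "\<dots> = pmf p x"
  proof (cases "overlap r p = 1")
    \<comment> \<open>Here \<open>residual\<close> is junk but has weight 0. The deficits are
      nonnegative and sum to 0, so there is nothing to fill.\<close>
    case True
    have "(\<Sum>v\<in>V. pmf p v - min (pmf r v) (pmf p v)) = 0"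
      using True by (simp add: sum_subtractf sum_p overlap_eq)
    then have "\<forall>v\<in>V. pmf p v - min (pmf r v) (pmf p v) = 0"
      by (subst (asm) sum_nonneg_eq_0_iff) (auto simp: finV)
    then have "min (pmf r x) (pmf p x) = pmf p x"
      by (cases "x \<in> V") (auto simp: outside)
    then show ?thesis using True by simp
  next
    case False then show ?thesis by (simp add: pmf_residual)
  qed
  finally show "pmf (bind_pmf r (repair r p)) x = pmf p x" .
qed

text \<open>A value can differ from its guess only after a rejection; averaging the rejection
  probability over \<open>r\<close> gives the total variation distance.\<close>

lemma repair_mismatch:
  "(\<integral>\<^sup>+ y. \<integral>\<^sup>+ x. of_bool (x \<noteq> y) \<partial>repair r p y \<partial>r) \<le> ennreal (1 - overlap r p)"
proof -
  let ?a = "\<lambda>y. min 1 (pmf p y / pmf r y)"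
  have "(\<integral>\<^sup>+ x. of_bool (x \<noteq> y) \<partial>repair r p y) \<le> ennreal (1 - ?a y)" for y
  proof -
    have "(\<integral>\<^sup>+ x. of_bool (x \<noteq> y) \<partial>repair r p y) = (\<integral>\<^sup>+ x. indicator (- {y}) x \<partial>repair r p y)"
      by (intro nn_integral_cong) (auto simp: indicator_def)
    also have "\<dots> = ennreal (measure_pmf.prob (repair r p y) (- {y}))"
      by (simp add: measure_pmf.emeasure_eq_measure)
    also have "measure_pmf.prob (repair r p y) (- {y}) = 1 - pmf (repair r p y) y"
      by (subst measure_pmf.prob_compl[of "{y}", simplified, folded Compl_eq_Diff_UNIV]) (auto simp: measure_pmf_single)
    also have "\<dots> \<le> 1 - ?a y"
      using keep_prob_bounds[of p y r] by (simp only: pmf_repair) (simp add: mult_nonneg_nonneg)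
    finally show ?thesis by (simp add: ennreal_leI)
  qed
  then have "(\<integral>\<^sup>+ y. \<integral>\<^sup>+ x. of_bool (x \<noteq> y) \<partial>repair r p y \<partial>r) \<le> (\<integral>\<^sup>+ y. ennreal (1 - ?a y) \<partial>r)"
    by (intro nn_integral_mono) simp
  also have "\<dots> = ennreal (measure_pmf.expectation r (\<lambda>y. 1 - ?a y))"
    using finV rV keep_prob_bounds(2)[of p _ r]
    by (intro nn_integral_eq_integral integrable_measure_pmf_finite) (auto intro: finite_subset)
  also have "measure_pmf.expectation r (\<lambda>y. 1 - ?a y) = 1 - overlap r p"
    unfolding expectation_r
    by (simp add: right_diff_distrib pmf_mult_keep_prob sum_subtractf sum_r overlap_eq del: min_def)
  finally show ?thesis .
qed

end

text \<open>Both terms come from \<open>a - b = (\<surd>a - \<surd>b) * (\<surd>a + \<surd>b)\<close> and the arithmetic-geometric mean inequality,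
  the second one by comparing the Hellinger distance with the relative entropy.\<close>

lemma excess_le:
  fixes a b \<epsilon> :: real
  assumes "0 \<le> a" "0 \<le> b" "0 < \<epsilon>" "a = 0 \<Longrightarrow> b = 0"
  shows "a - min a b \<le> 2 * \<epsilon> * (a + b) + (b * ln (b / a) + a - b) / (4 * \<epsilon>)"
proof -
  define s where "s = sqrt a"
  define t where "t = sqrt b"
  have st: "s \<ge> 0" "t \<ge> 0" "a = s\<^sup>2" "b = t\<^sup>2" using assms by (auto simp: s_def t_def)
  \<comment> \<open>This is \<open>ln u \<le> u - 1\<close> at \<open>u = s / t\<close>. The
    correction \<open>a - b\<close> makes each term nonnegative and cancels when summed over two
    probability vectors.\<close>
  have hell: "(s - t)\<^sup>2 \<le> b * ln (b / a) + a - b"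
  proof (cases "b = 0")
    case True then show ?thesis using st by simp
  next
    case False
    then have pos: "a > 0" "b > 0" using assms by force+
    then have pos': "s > 0" "t > 0" by (auto simp: s_def t_def)
    have "ln (s / t) \<le> s / t - 1" using pos' by (intro ln_le_minus_one) auto
    then have "2 * t\<^sup>2 * ln (s / t) \<le> 2 * t\<^sup>2 * (s / t - 1)"
      by (intro mult_left_mono) auto
    also have "\<dots> = 2 * s * t - 2 * t\<^sup>2" using pos' by (simp add: field_simps power2_eq_square)
    finally have "2 * t\<^sup>2 * ln (s / t) \<le> 2 * s * t - 2 * t\<^sup>2" .
    moreover have "ln (b / a) = - 2 * ln (s / t)"
      using pos' by (simp add: st ln_div ln_realpow)
    ultimately show ?thesis by (simp add: st power2_eq_square algebra_simps)
  qed
  have "s\<^sup>2 - t\<^sup>2 \<le> \<epsilon> * (s + t)\<^sup>2 + (s - t)\<^sup>2 / (4 * \<epsilon>)"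
  proof -
    have "0 \<le> (2 * \<epsilon> * (s + t) - (s - t))\<^sup>2" by simp
    then have "4 * \<epsilon> * (s\<^sup>2 - t\<^sup>2) \<le> 4 * \<epsilon> * (\<epsilon> * (s + t)\<^sup>2) + (s - t)\<^sup>2"
      by (simp add: power2_eq_square algebra_simps)
    then show ?thesis using assms(3) by (simp add: field_simps)
  qed
  also have "\<epsilon> * (s + t)\<^sup>2 \<le> 2 * \<epsilon> * (a + b)"
  proof -
    have "(s + t)\<^sup>2 \<le> 2 * (s\<^sup>2 + t\<^sup>2)"
      using zero_le_power2[of "s - t"] by (simp add: power2_eq_square algebra_simps)
    then show ?thesis using mult_left_mono[of "(s + t)\<^sup>2" "2 * (s\<^sup>2 + t\<^sup>2)" \<epsilon>] assms(3) st by (simp add: mult_ac)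
  qed
  also have "(s - t)\<^sup>2 / (4 * \<epsilon>) \<le> (b * ln (b / a) + a - b) / (4 * \<epsilon>)"
    using hell assms(3) by (intro divide_right_mono) auto
  finally have main: "a - b \<le> 2 * \<epsilon> * (a + b) + (b * ln (b / a) + a - b) / (4 * \<epsilon>)"
    by (simp add: st)
  have "0 \<le> b * ln (b / a) + a - b"
    using hell by (rule order_trans[OF zero_le_power2])
  then have "0 \<le> 2 * \<epsilon> * (a + b)" "0 \<le> (b * ln (b / a) + a - b) / (4 * \<epsilon>)"
    using assms by auto
  with main show ?thesis by (auto simp: min_def)
qed

definition KL :: "nat set \<Rightarrow> nat pmf \<Rightarrow> nat pmf \<Rightarrow> real" where
  "KL V p r = (\<Sum>v\<in>V. pmf p v * ln (pmf p v / pmf r v))"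

context finite_pmf_pair begin

text \<open>Sum \<open>excess_le\<close> over \<open>V\<close>, where both laws have mass 1. Unlike
  the square root in Pinsker's inequality, this bound is linear in the relative entropy, so it can
  be averaged and telescoped with one \<epsilon> for the whole run.\<close>

lemma excess_le_KL:
  assumes "0 < \<epsilon>" "\<And>v. pmf r v = 0 \<Longrightarrow> pmf p v = 0"
  shows "1 - overlap r p \<le> 4 * \<epsilon> + KL V p r / (4 * \<epsilon>)"
proof -
  have "1 - overlap r p = (\<Sum>v\<in>V. pmf r v - min (pmf r v) (pmf p v))"
    by (simp add: sum_subtractf sum_r overlap_eq)
  also have "\<dots> \<le> (\<Sum>v\<in>V. 2 * \<epsilon> * (pmf r v + pmf p v)
      + (pmf p v * ln (pmf p v / pmf r v) + pmf r v - pmf p v) / (4 * \<epsilon>))"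
    using assms by (intro sum_mono excess_le) auto
  also have "\<dots> = 2 * \<epsilon> * ((\<Sum>v\<in>V. pmf r v) + (\<Sum>v\<in>V. pmf p v))
      + (KL V p r + (\<Sum>v\<in>V. pmf r v) - (\<Sum>v\<in>V. pmf p v)) / (4 * \<epsilon>)"
    unfolding KL_def
    by (simp only: sum.distrib sum_distrib_left[symmetric] sum_divide_distrib[symmetric] sum_subtractf)
  finally show ?thesis by (simp add: sum_r sum_p)
qed

lemma KL_nonneg:
  assumes "\<And>v. pmf r v = 0 \<Longrightarrow> pmf p v = 0"
  shows "0 \<le> KL V p r"
proof -
  have "(\<Sum>v\<in>V. pmf p v - pmf r v) \<le> KL V p r"
    unfolding KL_def
  proof (rule sum_mono)
    fix v
    show "pmf p v - pmf r v \<le> pmf p v * ln (pmf p v / pmf r v)"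
    proof (cases "pmf p v = 0")
      case False
      then have pos: "pmf p v > 0" "pmf r v > 0" using assms[of v] by (auto simp: less_le)
      have "pmf p v * ln (pmf r v / pmf p v) \<le> pmf p v * (pmf r v / pmf p v - 1)"
        using pos by (intro mult_left_mono ln_le_minus_one) auto
      moreover have "pmf p v * (pmf r v / pmf p v - 1) = pmf r v - pmf p v"
        using pos by (simp add: field_simps)
      moreover have "ln (pmf r v / pmf p v) = - ln (pmf p v / pmf r v)"
        using pos by (simp add: ln_div)
      ultimately show ?thesis by simp
    qed simp
  qed
  then show ?thesis by (simp add: sum_subtractf sum_r sum_p)
qed

end


section \<open>Conditional entropies along a random order\<close>

locale spin_law =
  fixes \<mu> :: "(nat \<Rightarrow> nat) pmf" and n q :: nat
  assumes supp: "set_pmf \<mu> \<subseteq> PiE {1..n} (\<lambda>_. {1..q})"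
begin

text \<open>Conditioning on a full configuration \<open>x\<close>, of which only the values on
  \<open>S\<close> count, makes \<open>marg i S x\<close> the random conditional law of coordinate
  \<open>i\<close> when \<open>x\<close> is drawn from \<mu>. It is meaningful when the event has
  positive probability, in particular for \<open>x\<close> in the support.\<close>

definition marg :: "nat \<Rightarrow> nat set \<Rightarrow> (nat \<Rightarrow> nat) \<Rightarrow> nat pmf" where
  "marg i S x = map_pmf (\<lambda>y. y i) (cond_pmf \<mu> {y. \<forall>j\<in>S. y j = x j})"

lemma finite_supp: "finite (set_pmf \<mu>)"
  using supp by (rule finite_subset) (auto intro: finite_PiE)

lemma integrable_law: "integrable (measure_pmf \<mu>) f" for f :: "_ \<Rightarrow> real"
  by (rule integrable_measure_pmf_finite[OF finite_supp])

lemma supp_range: "x \<in> set_pmf \<mu> \<Longrightarrow> i \<in> {1..n} \<Longrightarrow> x i \<in> {1..q}"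
  using supp by (auto simp: PiE_def Pi_def)

lemma marg_cong: "(\<And>j. j \<in> S \<Longrightarrow> x j = x' j) \<Longrightarrow> marg i S x = marg i S x'"
  unfolding marg_def by (intro arg_cong2[where f=map_pmf] arg_cong2[where f=cond_pmf] refl) auto

lemma agree_nonempty: "x \<in> set_pmf \<mu> \<Longrightarrow> set_pmf \<mu> \<inter> {y. \<forall>j\<in>S. y j = x j} \<noteq> {}"
  by auto

lemma set_marg: "x \<in> set_pmf \<mu> \<Longrightarrow> set_pmf (marg i S x) = {y i | y. y \<in> set_pmf \<mu> \<and> (\<forall>j\<in>S. y j = x j)}"
  unfolding marg_def by (auto simp: set_cond_pmf[OF agree_nonempty])

lemma set_marg_subset: "x \<in> set_pmf \<mu> \<Longrightarrow> i \<in> {1..n} \<Longrightarrow> set_pmf (marg i S x) \<subseteq> {1..q}"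
  using supp_range by (auto simp: set_marg)

lemma finite_marg: "x \<in> set_pmf \<mu> \<Longrightarrow> i \<in> {1..n} \<Longrightarrow> finite (set_pmf (marg i S x))"
  by (rule finite_subset[OF set_marg_subset]) auto

lemma marg_self: "x \<in> set_pmf \<mu> \<Longrightarrow> x i \<in> set_pmf (marg i S x)"
  by (auto simp: set_marg)

lemma set_marg_antimono: "x \<in> set_pmf \<mu> \<Longrightarrow> S \<subseteq> T \<Longrightarrow> set_pmf (marg i T x) \<subseteq> set_pmf (marg i S x)"
  by (auto simp: set_marg)

text \<open>Agreement on \<open>S\<close> with a support point rules out a conditioning event of
  probability 0, hence the default answer of the oracle.\<close>

lemma cond_marg_eq:
  assumes x: "x \<in> set_pmf \<mu>" and \<sigma>: "\<And>j. j \<in> S \<Longrightarrow> \<sigma> j = x j"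
  shows "cond_marg \<mu> (i, S, \<sigma>) = pmf (marg i S x)"
proof
  fix v
  let ?E = "{y. \<forall>j\<in>S. y j = x j}"
  have "pmf (marg i S x) v = measure_pmf.prob (cond_pmf \<mu> ?E) {y. y i = v}"
    by (simp add: marg_def pmf_map vimage_def)
  also have "\<dots> = measure_pmf.prob \<mu> ({y. y i = v} \<inter> ?E) / measure_pmf.prob \<mu> ?E"
    unfolding cond_pmf.rep_eq[OF agree_nonempty[OF x]]
    using measure_pmf_zero_iff[of \<mu> ?E] agree_nonempty[OF x, of S]
    by (subst measure_uniform_measure) (auto simp: Int_commute measure_pmf.emeasure_eq_measure)
  also have "\<dots> = cond_marg \<mu> (i, S, \<sigma>) v"
    using \<sigma> by (simp add: cond_marg_def Int_def)
  finally show "cond_marg \<mu> (i, S, \<sigma>) v = pmf (marg i S x) v" by simp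
qed

text \<open>Redrawing a configuration conditioned on agreement with \<open>x\<close> on
  \<open>S\<close> reproduces \<mu> (\<open>bind_cond_pmf_cancel\<close>); then read off its values
  on \<open>S\<close> and at \<open>i\<close>.\<close>

lemma disintegration:
  "bind_pmf \<mu> (\<lambda>x. map_pmf (\<lambda>v. (restrict x S, v)) (marg i S x)) = map_pmf (\<lambda>x. (restrict x S, x i)) \<mu>"
proof -
  have "bind_pmf \<mu> (\<lambda>x. cond_pmf \<mu> {y. \<forall>j\<in>S. y j = x j}) = \<mu>"
  proof (rule bind_cond_pmf_cancel)
    fix x y assume "\<forall>j\<in>S. y j = (x j :: nat)"
    then show "measure_pmf.prob \<mu> {y. \<forall>j\<in>S. y j = x j} = measure_pmf.prob \<mu> {x. \<forall>j\<in>S. y j = x j}"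
      by (intro arg_cong[where f="measure_pmf.prob \<mu>"]) auto
  qed auto
  then have "map_pmf (\<lambda>x. (restrict x S, x i)) \<mu>
      = bind_pmf \<mu> (\<lambda>x. map_pmf (\<lambda>y. (restrict y S, y i)) (cond_pmf \<mu> {y. \<forall>j\<in>S. y j = x j}))"
    by (metis map_bind_pmf)
  also have "\<dots> = bind_pmf \<mu> (\<lambda>x. map_pmf (\<lambda>v. (restrict x S, v)) (marg i S x))"
    unfolding marg_def pmf.map_comp
    by (intro bind_pmf_cong refl map_pmf_cong) (auto simp: set_cond_pmf[OF agree_nonempty] restrict_def fun_eq_iff)
  finally show ?thesis by simp
qed

text \<open>Total expectation given the values on \<open>S\<close>. The assumption on \<phi> says
  that its first argument matters only on \<open>S\<close>, which is what
  \<open>disintegration\<close> retains.\<close>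

lemma tower:
  fixes \<phi> :: "(nat \<Rightarrow> nat) \<Rightarrow> nat \<Rightarrow> real"
  assumes i: "i \<in> {1..n}" and \<phi>: "\<And>x v. \<phi> (restrict x S) v = \<phi> x v"
  shows "measure_pmf.expectation \<mu> (\<lambda>x. \<phi> x (x i))
    = measure_pmf.expectation \<mu> (\<lambda>x. \<Sum>v\<in>{1..q}. pmf (marg i S x) v * \<phi> x v)"
proof -
  let ?D = "bind_pmf \<mu> (\<lambda>x. map_pmf (\<lambda>v. (restrict x S, v)) (marg i S x))"
  have fin: "finite (set_pmf ?D)"
    unfolding disintegration using finite_supp by simp
  have "measure_pmf.expectation \<mu> (\<lambda>x. \<phi> x (x i))
      = measure_pmf.expectation (map_pmf (\<lambda>x. (restrict x S, x i)) \<mu>) (\<lambda>(u, v). \<phi> u v)"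
    by (simp add: \<phi>)
  also have "\<dots> = measure_pmf.expectation ?D (\<lambda>(u, v). \<phi> u v)"
    by (simp only: disintegration)
  also have "\<dots> = (\<Sum>x\<in>set_pmf \<mu>. pmf \<mu> x *\<^sub>R measure_pmf.expectation (map_pmf (\<lambda>v. (restrict x S, v)) (marg i S x)) (\<lambda>(u, v). \<phi> u v))"
    using finite_marg[OF _ i] by (intro pmf_expectation_bind finite_supp order_refl) auto
  also have "\<dots> = (\<Sum>x\<in>set_pmf \<mu>. pmf \<mu> x * (\<Sum>v\<in>{1..q}. pmf (marg i S x) v * \<phi> x v))"
  proof (rule sum.cong[OF refl])
    fix x assume "x \<in> set_pmf \<mu>"
    then have "measure_pmf.expectation (marg i S x) (\<phi> x) = (\<Sum>v\<in>{1..q}. \<phi> x v * pmf (marg i S x) v)"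
      using set_marg_subset[of x i S] i by (intro integral_measure_pmf_real) blast+
    then show "pmf \<mu> x *\<^sub>R measure_pmf.expectation (map_pmf (\<lambda>v. (restrict x S, v)) (marg i S x)) (\<lambda>(u, v). \<phi> u v)
        = pmf \<mu> x * (\<Sum>v\<in>{1..q}. pmf (marg i S x) v * \<phi> x v)"
      by (simp add: \<phi> mult.commute)
  qed
  also have "\<dots> = measure_pmf.expectation \<mu> (\<lambda>x. \<Sum>v\<in>{1..q}. pmf (marg i S x) v * \<phi> x v)"
    by (subst integral_measure_pmf_real[OF finite_supp]) (auto simp: mult.commute)
  finally show ?thesis .
qed

text \<open>The Shannon entropy of coordinate \<open>i\<close> given the coordinates in
  \<open>S\<close>, in nats, as an expected surprisal.\<close>

definition cond_entropy :: "nat \<Rightarrow> nat set \<Rightarrow> real" where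
  "cond_entropy i S = measure_pmf.expectation \<mu> (\<lambda>x. - ln (pmf (marg i S x) (x i)))"

lemma cond_entropy_nonneg: "0 \<le> cond_entropy i S"
  unfolding cond_entropy_def
proof (rule integral_nonneg_AE, rule AE_pmfI)
  fix x assume "x \<in> set_pmf \<mu>"
  then have "pmf (marg i S x) (x i) > 0" using marg_self by (simp add: pmf_positive)
  then show "0 \<le> - ln (pmf (marg i S x) (x i))" by (simp add: pmf_le_1)
qed

lemma marg_pair:
  assumes "x \<in> set_pmf \<mu>" "i \<in> {1..n}"
  shows "finite_pmf_pair (marg i S x) (marg i T x) {1..q}"
  by unfold_locales (use assms set_marg_subset in auto)

lemma marg_absolutely_continuous:
  "x \<in> set_pmf \<mu> \<Longrightarrow> S \<subseteq> T \<Longrightarrow> pmf (marg i S x) v = 0 \<Longrightarrow> pmf (marg i T x) v = 0"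
  using set_marg_antimono[of x S T i] by (auto simp: pmf_eq_0_set_pmf)

text \<open>The difference of the surprisals is a log-likelihood ratio; averaging it over coordinate
  \<open>i\<close> given the coordinates in \<open>T\<close> turns it into a relative entropy. The
  common value is a conditional mutual information.\<close>

lemma cond_entropy_diff:
  assumes i: "i \<in> {1..n}" and ST: "S \<subseteq> T"
  shows "cond_entropy i S - cond_entropy i T
    = measure_pmf.expectation \<mu> (\<lambda>x. KL {1..q} (marg i T x) (marg i S x))"
proof -
  define \<phi> where "\<phi> = (\<lambda>x v. ln (pmf (marg i T x) v) - ln (pmf (marg i S x) v))"
  have "cond_entropy i S - cond_entropy i T = measure_pmf.expectation \<mu> (\<lambda>x. \<phi> x (x i))"
    unfolding cond_entropy_def \<phi>_def
    by (subst Bochner_Integration.integral_diff[symmetric]) (auto intro: integrable_law simp: algebra_simps)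
  also have "\<dots> = measure_pmf.expectation \<mu> (\<lambda>x. \<Sum>v\<in>{1..q}. pmf (marg i T x) v * \<phi> x v)"
  proof (rule tower[OF i])
    fix x v
    have "marg i T (restrict x T) = marg i T x" "marg i S (restrict x T) = marg i S x"
      using ST by (auto intro!: marg_cong)
    then show "\<phi> (restrict x T) v = \<phi> x v" by (simp add: \<phi>_def)
  qed
  also have "\<dots> = measure_pmf.expectation \<mu> (\<lambda>x. KL {1..q} (marg i T x) (marg i S x))"
  proof (rule integral_cong_AE)
    show "AE x in \<mu>. (\<Sum>v\<in>{1..q}. pmf (marg i T x) v * \<phi> x v) = KL {1..q} (marg i T x) (marg i S x)"
    proof (rule AE_pmfI)
      fix x assume x: "x \<in> set_pmf \<mu>"
      show "(\<Sum>v\<in>{1..q}. pmf (marg i T x) v * \<phi> x v) = KL {1..q} (marg i T x) (marg i S x)"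
        unfolding KL_def
      proof (rule sum.cong[OF refl])
        fix v
        show "pmf (marg i T x) v * \<phi> x v = pmf (marg i T x) v * ln (pmf (marg i T x) v / pmf (marg i S x) v)"
        proof (cases "pmf (marg i T x) v = 0")
          case False
          then have "pmf (marg i T x) v > 0" "pmf (marg i S x) v > 0"
            using marg_absolutely_continuous[OF x ST] by (auto simp: less_le)
          then show ?thesis by (simp add: \<phi>_def ln_div)
        qed simp
      qed
    qed
  qed auto
  finally show ?thesis .
qed

lemma cond_entropy_antimono:
  assumes i: "i \<in> {1..n}" and ST: "S \<subseteq> T"
  shows "cond_entropy i T \<le> cond_entropy i S"
proof -
  have "0 \<le> measure_pmf.expectation \<mu> (\<lambda>x. KL {1..q} (marg i T x) (marg i S x))"
  proof (rule integral_nonneg_AE, rule AE_pmfI)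
    fix x assume x: "x \<in> set_pmf \<mu>"
    interpret finite_pmf_pair "marg i S x" "marg i T x" "{1..q}" by (rule marg_pair[OF x i])
    show "0 \<le> KL {1..q} (marg i T x) (marg i S x)"
      by (rule KL_nonneg) (rule marg_absolutely_continuous[OF x ST])
  qed
  then show ?thesis unfolding cond_entropy_diff[OF i ST, symmetric] by simp
qed

text \<open>Gibbs' inequality against the uniform law: the pointwise corrections
  \<open>1 / real q - ?p v\<close> sum to 0.\<close>

lemma cond_entropy_le:
  assumes i: "i \<in> {1..n}" and q: "q > 0"
  shows "cond_entropy i S \<le> ln (real q)"
proof -
  have "cond_entropy i S = measure_pmf.expectation \<mu> (\<lambda>x. \<Sum>v\<in>{1..q}. pmf (marg i S x) v * - ln (pmf (marg i S x) v))"
    unfolding cond_entropy_def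
  proof (rule tower[OF i, where \<phi>="\<lambda>x v. - ln (pmf (marg i S x) v)"])
    fix x v
    have "marg i S (restrict x S) = marg i S x" by (auto intro!: marg_cong)
    then show "- ln (pmf (marg i S (restrict x S)) v) = - ln (pmf (marg i S x) v)" by simp
  qed
  also have "\<dots> \<le> measure_pmf.expectation \<mu> (\<lambda>x. ln (real q))"
  proof (rule integral_mono_AE)
    show "AE x in \<mu>. (\<Sum>v\<in>{1..q}. pmf (marg i S x) v * - ln (pmf (marg i S x) v)) \<le> ln (real q)"
    proof (rule AE_pmfI)
      fix x assume x: "x \<in> set_pmf \<mu>"
      let ?p = "pmf (marg i S x)"
      have s: "(\<Sum>v\<in>{1..q}. ?p v) = 1"
        by (rule sum_pmf_eq_1) (use set_marg_subset[OF x i] in auto)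
      have "(\<Sum>v\<in>{1..q}. ?p v * - ln (?p v)) \<le> (\<Sum>v\<in>{1..q}. ?p v * ln (real q) + (1 / real q - ?p v))"
      proof (rule sum_mono)
        fix v
        show "?p v * - ln (?p v) \<le> ?p v * ln (real q) + (1 / real q - ?p v)"
        proof (cases "?p v = 0")
          case False
          then have pos: "?p v > 0" by (simp add: less_le)
          have "?p v * ln (1 / (real q * ?p v)) \<le> ?p v * (1 / (real q * ?p v) - 1)"
            using pos q by (intro mult_left_mono ln_le_minus_one) auto
          moreover have "?p v * (1 / (real q * ?p v) - 1) = 1 / real q - ?p v"
            using pos q by (simp add: field_simps)
          moreover have "ln (1 / (real q * ?p v)) = - ln (real q) - ln (?p v)"
            using pos q by (simp add: ln_div ln_mult)
          ultimately show ?thesis by (simp add: algebra_simps)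
        qed simp
      qed
      also have "\<dots> = ln (real q)"
        using q by (simp only: sum.distrib sum_subtractf sum_distrib_right[symmetric] s) simp
      finally show "(\<Sum>v\<in>{1..q}. ?p v * - ln (?p v)) \<le> ln (real q)" .
    qed
  qed (auto intro: integrable_law)
  also have "\<dots> = ln (real q)" by simp
  finally show ?thesis .
qed

text \<open>Since \<open>excess_le_KL\<close> is linear in the relative entropy, taking expectations
  leaves an entropy drop.\<close>

lemma expected_excess_le:
  fixes \<epsilon> :: real
  assumes i: "i \<in> {1..n}" and ST: "S \<subseteq> T" and \<epsilon>: "0 < \<epsilon>"
  shows "measure_pmf.expectation \<mu> (\<lambda>x. 1 - overlap (marg i S x) (marg i T x))
    \<le> 4 * \<epsilon> + (cond_entropy i S - cond_entropy i T) / (4 * \<epsilon>)"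
proof -
  have "measure_pmf.expectation \<mu> (\<lambda>x. 1 - overlap (marg i S x) (marg i T x))
    \<le> measure_pmf.expectation \<mu> (\<lambda>x. 4 * \<epsilon> + KL {1..q} (marg i T x) (marg i S x) / (4 * \<epsilon>))"
  proof (rule integral_mono_AE)
    show "AE x in \<mu>. 1 - overlap (marg i S x) (marg i T x) \<le> 4 * \<epsilon> + KL {1..q} (marg i T x) (marg i S x) / (4 * \<epsilon>)"
    proof (rule AE_pmfI)
      fix x assume x: "x \<in> set_pmf \<mu>"
      interpret finite_pmf_pair "marg i S x" "marg i T x" "{1..q}" by (rule marg_pair[OF x i])
      show "1 - overlap (marg i S x) (marg i T x) \<le> 4 * \<epsilon> + KL {1..q} (marg i T x) (marg i S x) / (4 * \<epsilon>)"
        by (rule excess_le_KL[OF \<epsilon>]) (rule marg_absolutely_continuous[OF x ST])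
    qed
  qed (auto intro: integrable_law)
  also have "\<dots> = 4 * \<epsilon> + (cond_entropy i S - cond_entropy i T) / (4 * \<epsilon>)"
    unfolding cond_entropy_diff[OF i ST]
    by (subst Bochner_Integration.integral_add) (auto intro: integrable_law)
  finally show ?thesis .
qed

section \<open>Entropies averaged over a uniformly random order\<close>

definition orders :: "nat list set" where
  "orders = permutations_of_set {1..n}"

lemma finite_orders: "finite orders" and orders_nonempty: "orders \<noteq> {}"
  by (auto simp: orders_def)

lemma ordersD:
  assumes "\<rho> \<in> orders"
  shows "set \<rho> = {1..n}" "distinct \<rho>" "length \<rho> = n"
  using assms by (auto simp: orders_def permutations_of_set_def dest: distinct_card)

lemma orders_nth: "\<rho> \<in> orders \<Longrightarrow> j < n \<Longrightarrow> \<rho> ! j \<in> {1..n}"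
  using ordersD[of \<rho>] nth_mem[of j \<rho>] by auto

text \<open>\<open>card orders\<close> times the entropy of the coordinate at position \<open>j\<close> of a random order
  given the coordinates at positions below \<open>t\<close>.\<close>

definition order_entropy :: "nat \<Rightarrow> nat \<Rightarrow> real" where
  "order_entropy j t = (\<Sum>\<rho>\<in>orders. cond_entropy (\<rho> ! j) (set (take t \<rho>)))"

text \<open>Exchangeability: swapping positions \<open>t\<close> and \<open>j\<close> is an
  involution on the orders that keeps the first \<open>t\<close> entries.\<close>

lemma order_entropy_swap:
  assumes "t \<le> j" "j < n"
  shows "order_entropy j t = order_entropy t t"
proof -
  define \<tau> :: "nat list \<Rightarrow> nat list" where "\<tau> = (\<lambda>\<rho>. \<rho>[t := \<rho> ! j, j := \<rho> ! t])"
  have \<tau>: "\<tau> \<rho> \<in> orders" "\<tau> (\<tau> \<rho>) = \<rho>"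
    "cond_entropy (\<tau> \<rho> ! t) (set (take t (\<tau> \<rho>))) = cond_entropy (\<rho> ! j) (set (take t \<rho>))"
    if \<rho>: "\<rho> \<in> orders" for \<rho>
  proof -
    have len: "t < length \<rho>" "j < length \<rho>" using ordersD[OF \<rho>] assms by auto
    show "\<tau> \<rho> \<in> orders" using \<rho> len
      by (auto simp: \<tau>_def orders_def permutations_of_set_def set_swap distinct_swap)
    show "\<tau> (\<tau> \<rho>) = \<rho>"
      unfolding \<tau>_def using len by (intro nth_equalityI) (auto simp: nth_list_update)
    show "cond_entropy (\<tau> \<rho> ! t) (set (take t (\<tau> \<rho>))) = cond_entropy (\<rho> ! j) (set (take t \<rho>))"
      unfolding \<tau>_def using len assms by (auto simp: nth_list_update)
  qed
  show ?thesis
    unfolding order_entropy_def by (rule sum.reindex_bij_witness[where i=\<tau> and j=\<tau>]) (use \<tau> in auto)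
qed

lemma order_entropy_antimono:
  assumes "s \<le> t" "t \<le> j" "j < n"
  shows "order_entropy j t \<le> order_entropy j s"
  unfolding order_entropy_def
proof (rule sum_mono)
  fix \<rho> assume \<rho>: "\<rho> \<in> orders"
  show "cond_entropy (\<rho> ! j) (set (take t \<rho>)) \<le> cond_entropy (\<rho> ! j) (set (take s \<rho>))"
    using assms by (intro cond_entropy_antimono orders_nth[OF \<rho>] set_take_subset_set_take)
qed

text \<open>A block start lags behind \<open>j\<close> by less than \<open>L\<close>, so
  \<open>h\<close> there is at most its value at lag exactly \<open>L\<close>. Summing over
  \<open>j\<close> then shifts the sequence by \<open>L\<close>; the sums cancel up to
  \<open>L\<close> leading terms, all equal to \<open>h 0\<close> by truncated subtraction.\<close>

lemma lag_sum_le: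
  fixes h :: "nat \<Rightarrow> real"
  assumes dec: "\<And>s t. s \<le> t \<Longrightarrow> t < n \<Longrightarrow> h t \<le> h s" and nn: "\<And>t. t < n \<Longrightarrow> 0 \<le> h t" and L: "L > 0" and n: "n > 0"
  shows "(\<Sum>j<n. h (L * (j div L)) - h j) \<le> L * h 0"
proof -
  have "(\<Sum>j<n. h (L * (j div L))) \<le> (\<Sum>j<n. h (j - L))"
  proof (rule sum_mono)
    fix j assume j: "j \<in> {..<n}"
    have "j mod L < L" using L by simp
    then have "j - L \<le> L * (j div L)" using mult_div_mod_eq[of L j] by linarith
    then show "h (L * (j div L)) \<le> h (j - L)"
      using j by (intro dec) (auto intro: le_less_trans[OF times_div_less_eq_dividend])
  qed
  also have "\<dots> \<le> L * h 0 + (\<Sum>j<n. h j)"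
  proof (cases "L \<le> n")
    case True
    have "(\<Sum>j<n. h (j - L)) = (\<Sum>j<L. h (j - L)) + (\<Sum>j\<in>{L..<n}. h (j - L))"
      using True by (subst sum.union_disjoint[symmetric]) (auto intro!: sum.cong)
    also have "(\<Sum>j<L. h (j - L)) = L * h 0" by simp
    also have "(\<Sum>j\<in>{L..<n}. h (j - L)) = (\<Sum>j<n - L. h j)"
      by (rule sum.reindex_bij_witness[where i="\<lambda>j. j + L" and j="\<lambda>j. j - L"]) auto
    also have "\<dots> \<le> (\<Sum>j<n. h j)"
      by (rule sum_mono2) (auto intro: nn)
    finally show ?thesis by simp
  next
    case False
    then have "(\<Sum>j<n. h (j - L)) = n * h 0" by simp
    also have "\<dots> \<le> L * h 0" using False nn[of 0] n by (intro mult_right_mono) auto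
    finally have "(\<Sum>j<n. h (j - L)) \<le> L * h 0" .
    moreover have "0 \<le> (\<Sum>j<n. h j)" by (intro sum_nonneg nn) auto
    ultimately show ?thesis by linarith
  qed
  finally show ?thesis by (simp add: sum_subtractf)
qed

lemma expected_excess_sum_le:
  fixes \<epsilon> :: real and L :: nat
  assumes L: "L > 0" and \<epsilon>: "0 < \<epsilon>" and n: "n > 0" and q: "q > 0"
  shows "(\<Sum>\<rho>\<in>orders. \<Sum>j<n. measure_pmf.expectation \<mu> (\<lambda>x.
       1 - overlap (marg (\<rho> ! j) (set (take (L * (j div L)) \<rho>)) x) (marg (\<rho> ! j) (set (take j \<rho>)) x)))
    \<le> real (card orders) * (4 * \<epsilon> * n + L * ln (real q) / (4 * \<epsilon>))"
proof -
  have "(\<Sum>\<rho>\<in>orders. \<Sum>j<n. measure_pmf.expectation \<mu> (\<lambda>x.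
       1 - overlap (marg (\<rho> ! j) (set (take (L * (j div L)) \<rho>)) x) (marg (\<rho> ! j) (set (take j \<rho>)) x)))
    \<le> (\<Sum>\<rho>\<in>orders. \<Sum>j<n. 4 * \<epsilon> + (cond_entropy (\<rho> ! j) (set (take (L * (j div L)) \<rho>)) - cond_entropy (\<rho> ! j) (set (take j \<rho>))) / (4 * \<epsilon>))"
    using \<epsilon> by (intro sum_mono expected_excess_le orders_nth set_take_subset_set_take) auto
  also have "\<dots> = real (card orders) * (4 * \<epsilon> * n) + (\<Sum>j<n. order_entropy j (L * (j div L)) - order_entropy j j) / (4 * \<epsilon>)"
    unfolding order_entropy_def
    by (subst sum.swap) (simp add: sum.distrib sum_divide_distrib[symmetric] sum_subtractf)
  \<comment> \<open>Exchangeability replaces position \<open>j\<close> by the block start itself,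
    leaving a one-parameter sequence to which \<open>lag_sum_le\<close> applies.\<close>
  also have "(\<Sum>j<n. order_entropy j (L * (j div L)) - order_entropy j j) = (\<Sum>j<n. order_entropy (L * (j div L)) (L * (j div L)) - order_entropy j j)"
    by (intro sum.cong arg_cong2[where f="(-)"] order_entropy_swap refl) auto
  also have "\<dots> \<le> L * order_entropy 0 0"
  proof (rule lag_sum_le[OF _ _ L n])
    \<comment> \<open>Position \<open>s\<close> may be traded for position \<open>t\<close> given
      the first \<open>s\<close> entries; conditioning on further entries then lowers the
      entropy.\<close>
    fix s t assume "s \<le> t" "t < n"
    then show "order_entropy t t \<le> order_entropy s s" using order_entropy_swap[of s t] order_entropy_antimono[of s t t] by simp
  qed (auto simp: order_entropy_def intro!: sum_nonneg cond_entropy_nonneg)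
  also have "order_entropy 0 0 \<le> (\<Sum>\<rho>\<in>orders. ln (real q))"
    unfolding order_entropy_def using n q by (intro sum_mono cond_entropy_le orders_nth) auto
  finally show ?thesis using \<epsilon> L by (simp add: field_simps mult_left_mono divide_right_mono)
qed

end


section \<open>The chain of guesses and repairs\<close>

text \<open>Unspecified off the revealed coordinates, where the oracle never reads it. As a function
  of \<open>\<rho>\<close> and \<open>xs\<close> it makes equal prefixes give literally equal
  queries, as the transcript lookup requires.\<close>

definition assignment :: "nat list \<Rightarrow> nat list \<Rightarrow> nat \<Rightarrow> nat" where
  "assignment \<rho> xs i = the (map_of (zip (take (length xs) \<rho>) xs) i)"

definition prefix_query :: "nat list \<Rightarrow> nat \<Rightarrow> nat list \<Rightarrow> query" where
  "prefix_query \<rho> j xs = (\<rho> ! j, set (take (length xs) \<rho>), assignment \<rho> xs)"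

text \<open>The law whose mass function is a given oracle answer; meaningless for answers that are not
  probability vectors, which occur only when the conditioning event has probability 0.\<close>

definition law_of :: "answer \<Rightarrow> nat pmf" where
  "law_of a = (SOME p. pmf p = a)"

lemma law_of_pmf [simp]: "law_of (pmf p) = p"
  unfolding law_of_def by (rule some_equality) (auto intro: pmf_eqI)

lemma assignment_map: "i \<in> set (take t \<rho>) \<Longrightarrow> assignment \<rho> (map x (take t \<rho>)) i = x i"
proof -
  have "take (length (map x (take t \<rho>))) \<rho> = take t \<rho>" by (simp add: min_def)
  then show "i \<in> set (take t \<rho>) \<Longrightarrow> ?thesis"
    unfolding assignment_def by (simp only: map_of_zip_map) simp
qed

definition guess_law :: "(query \<Rightarrow> answer) \<Rightarrow> nat \<Rightarrow> nat list \<Rightarrow> nat list \<Rightarrow> nat \<Rightarrow> nat pmf" where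
  "guess_law g L \<rho> xs j = law_of (g (prefix_query \<rho> j (take (L * (j div L)) xs)))"

definition true_law :: "(query \<Rightarrow> answer) \<Rightarrow> nat list \<Rightarrow> nat list \<Rightarrow> nat \<Rightarrow> nat pmf" where
  "true_law g \<rho> xs j = law_of (g (prefix_query \<rho> j (take j xs)))"

text \<open>Entry \<open>(x, y)\<close> of the chain consists of the final value \<open>x\<close> and the guess \<open>y\<close>.\<close>

fun chain_law :: "(query \<Rightarrow> answer) \<Rightarrow> nat \<Rightarrow> nat list \<Rightarrow> nat \<Rightarrow> (nat \<times> nat) list pmf" where
  "chain_law g L \<rho> 0 = return_pmf []"
| "chain_law g L \<rho> (Suc j) = bind_pmf (chain_law g L \<rho> j) (\<lambda>zs.
     bind_pmf (guess_law g L \<rho> (map fst zs) j) (\<lambda>y.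
       map_pmf (\<lambda>x. zs @ [(x, y)]) (repair (guess_law g L \<rho> (map fst zs) j) (true_law g \<rho> (map fst zs) j) y)))"

text \<open>The sequential process that the rounds simulate. Coins belong to positions, not to
  rounds, so the values do not depend on how the run is cut into rounds.\<close>

fun chain :: "(query \<Rightarrow> answer) \<Rightarrow> nat \<Rightarrow> nat list \<Rightarrow> (nat \<Rightarrow> bool) \<Rightarrow> nat \<Rightarrow> (nat \<times> nat) list" where
  "chain g L \<rho> \<omega> 0 = []"
| "chain g L \<rho> \<omega> (Suc j) = (let zs = chain g L \<rho> \<omega> j;
     y = sampler (guess_law g L \<rho> (map fst zs) j) (coin_block (2 * j + 1) \<omega>);
     x = sampler (repair (guess_law g L \<rho> (map fst zs) j) (true_law g \<rho> (map fst zs) j) y) (coin_block (2 * j + 2) \<omega>)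
   in zs @ [(x, y)])"

lemma length_chain [simp]: "length (chain g L \<rho> \<omega> j) = j"
  by (induction j) (auto simp: Let_def)

definition random_order :: "nat \<Rightarrow> (nat \<Rightarrow> bool) \<Rightarrow> nat list" where
  "random_order n \<omega> = sampler (pmf_of_set (permutations_of_set {1..n})) (coin_block 0 \<omega>)"

text \<open>Block 0 draws the order and each position uses two fresh blocks, one for the guess and
  one for the repair.\<close>

lemma dist_by_chain:
  "dist_by (2 * j + 1) (\<lambda>\<omega>. (random_order n \<omega>, chain g L (random_order n \<omega>) \<omega> j))
    (bind_pmf (pmf_of_set (permutations_of_set {1..n})) (\<lambda>\<rho>. map_pmf (Pair \<rho>) (chain_law g L \<rho> j)))"
proof (induction j)
  case 0
  have "dist_by 1 (\<lambda>\<omega>. ((), random_order n \<omega>)) (bind_pmf (return_pmf ()) (\<lambda>s. map_pmf (Pair s) (pmf_of_set (permutations_of_set {1..n}))))"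
    using dist_by_bind[OF dist_by_return[of 0 "()"], of "\<lambda>_. pmf_of_set (permutations_of_set {1..n})"]
    by (simp add: random_order_def)
  from dist_by_map[OF this, of "\<lambda>(u, \<rho>). (\<rho>, [])"] show ?case
    by (simp add: bind_return_pmf pmf.map_comp comp_def map_pmf_def[symmetric])
next
  case (Suc j)
  let ?g = "\<lambda>(\<rho>, zs). guess_law g L \<rho> (map fst zs) j"
  let ?r = "\<lambda>((\<rho>, zs), y). repair (guess_law g L \<rho> (map fst zs) j) (true_law g \<rho> (map fst zs) j) y"
  let ?h = "\<lambda>(((\<rho>, zs), y), x). (\<rho>, zs @ [(x, y)])"
  from dist_by_map[OF dist_by_bind[OF dist_by_bind[OF Suc, of ?g], of ?r], of ?h]
  show ?case
    by (simp add: map_bind_pmf bind_map_pmf bind_assoc_pmf pmf.map_comp comp_def Let_def)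
qed

definition mistakes :: "(nat \<times> nat) list \<Rightarrow> nat" where
  "mistakes zs = length (filter (\<lambda>(x, y). x \<noteq> y) zs)"

section \<open>Exactness and expected mistakes of the chain\<close>

context spin_law begin

abbreviation block_start :: "nat \<Rightarrow> nat \<Rightarrow> nat" where
  "block_start L j \<equiv> L * (j div L)"

lemma query_answer:
  assumes "x \<in> set_pmf \<mu>"
  shows "cond_marg \<mu> (prefix_query \<rho> j (map x (take t \<rho>))) = pmf (marg (\<rho> ! j) (set (take t \<rho>)) x)"
proof -
  have tk: "take (length (map x (take t \<rho>))) \<rho> = take t \<rho>" by (simp add: min_def)
  show ?thesis
    unfolding prefix_query_def tk by (rule cond_marg_eq[OF assms(1)]) (rule assignment_map)
qed

lemma guess_law_eq:
  assumes "x \<in> set_pmf \<mu>"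
  shows "guess_law (cond_marg \<mu>) L \<rho> (map x (take j \<rho>)) j = marg (\<rho> ! j) (set (take (block_start L j) \<rho>)) x"
proof -
  have "block_start L j \<le> j" by simp
  then have "take (block_start L j) (map x (take j \<rho>)) = map x (take (block_start L j) \<rho>)"
    by (simp add: take_map min_def del: times_div_less_eq_dividend)
  then show ?thesis unfolding guess_law_def
    using query_answer[OF assms, where j=j and t="block_start L j" and \<rho>=\<rho>] by simp
qed

lemma true_law_eq:
  assumes "x \<in> set_pmf \<mu>"
  shows "true_law (cond_marg \<mu>) \<rho> (map x (take j \<rho>)) j = marg (\<rho> ! j) (set (take j \<rho>)) x"
  unfolding true_law_def using query_answer[OF assms, where j=j and t=j and \<rho>=\<rho>] by (simp add: take_map)

text \<open>By induction the prefix is that of a support point of \<mu>, so the oracle returns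
  genuine conditional laws. Whatever the guess law, \<open>bind_repair\<close> then yields the true
  one, and \<open>disintegration\<close> extends the prefix by one coordinate.\<close>

lemma map_fst_chain_law:
  assumes \<rho>: "\<rho> \<in> orders" and "j \<le> n"
  shows "map_pmf (map fst) (chain_law (cond_marg \<mu>) L \<rho> j) = map_pmf (\<lambda>x. map x (take j \<rho>)) \<mu>"
  using assms(2)
proof (induction j)
  case 0
  show ?case by (simp add: map_pmf_const)
next
  case (Suc j)
  let ?g = "cond_marg \<mu>"
  have IH: "map_pmf (map fst) (chain_law ?g L \<rho> j) = map_pmf (\<lambda>x. map x (take j \<rho>)) \<mu>"
    using Suc by simp
  have j: "j < n" "j < length \<rho>" using Suc ordersD[OF \<rho>] by auto
  let ?S = "set (take j \<rho>)"
  have "map_pmf (map fst) (chain_law ?g L \<rho> (Suc j))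
     = bind_pmf (chain_law ?g L \<rho> j) (\<lambda>zs. map_pmf (\<lambda>x. map fst zs @ [x])
        (bind_pmf (guess_law ?g L \<rho> (map fst zs) j) (repair (guess_law ?g L \<rho> (map fst zs) j) (true_law ?g \<rho> (map fst zs) j))))"
    by (simp add: map_bind_pmf pmf.map_comp comp_def)
  also have "\<dots> = bind_pmf (map_pmf (map fst) (chain_law ?g L \<rho> j)) (\<lambda>xs. map_pmf (\<lambda>x. xs @ [x])
        (bind_pmf (guess_law ?g L \<rho> xs j) (repair (guess_law ?g L \<rho> xs j) (true_law ?g \<rho> xs j))))"
    by (simp add: bind_map_pmf)
  also have "\<dots> = bind_pmf \<mu> (\<lambda>x. map_pmf (\<lambda>v. map x (take j \<rho>) @ [v]) (marg (\<rho> ! j) ?S x))"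
    unfolding IH bind_map_pmf
  proof (rule bind_pmf_cong[OF refl])
    fix x assume x: "x \<in> set_pmf \<mu>"
    interpret finite_pmf_pair "marg (\<rho> ! j) (set (take (block_start L j) \<rho>)) x" "marg (\<rho> ! j) ?S x" "{1..q}"
      by (rule marg_pair[OF x orders_nth[OF \<rho> j(1)]])
    show "map_pmf (\<lambda>xa. map x (take j \<rho>) @ [xa])
        (bind_pmf (guess_law ?g L \<rho> (map x (take j \<rho>)) j) (repair (guess_law ?g L \<rho> (map x (take j \<rho>)) j) (true_law ?g \<rho> (map x (take j \<rho>)) j)))
      = map_pmf (\<lambda>v. map x (take j \<rho>) @ [v]) (marg (\<rho> ! j) ?S x)"
      by (simp only: guess_law_eq[OF x] true_law_eq[OF x] bind_repair)
  qed
  also have "\<dots> = map_pmf (\<lambda>(u, v). map u (take j \<rho>) @ [v]) (bind_pmf \<mu> (\<lambda>x. map_pmf (\<lambda>v. (restrict x ?S, v)) (marg (\<rho> ! j) ?S x)))"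
    by (simp add: map_bind_pmf pmf.map_comp comp_def cong: map_cong)
  also have "\<dots> = map_pmf (\<lambda>x. map x (take (Suc j) \<rho>)) \<mu>"
    unfolding disintegration using j by (simp add: pmf.map_comp comp_def take_Suc_conv_app_nth cong: map_cong)
  finally show ?case .
qed

text \<open>The chance of a mistake at \<open>j\<close> depends on the past only through the final
  values, whose law is known from \<open>map_fst_chain_law\<close>; so it can be averaged over \<mu>
  instead of over the chain.\<close>

lemma expected_mistakes_step:
  assumes \<rho>: "\<rho> \<in> orders" and j: "j < n"
  shows "(\<integral>\<^sup>+ zs. of_nat (mistakes zs) \<partial>chain_law (cond_marg \<mu>) L \<rho> (Suc j))
    \<le> (\<integral>\<^sup>+ zs. of_nat (mistakes zs) \<partial>chain_law (cond_marg \<mu>) L \<rho> j)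
      + ennreal (measure_pmf.expectation \<mu> (\<lambda>x. 1 - overlap (marg (\<rho> ! j) (set (take (block_start L j) \<rho>)) x) (marg (\<rho> ! j) (set (take j \<rho>)) x)))"
proof -
  let ?g = "cond_marg \<mu>"
  let ?r = "\<lambda>xs. guess_law ?g L \<rho> xs j" and ?p = "\<lambda>xs. true_law ?g \<rho> xs j"
  let ?m = "\<lambda>xs. \<integral>\<^sup>+ y. \<integral>\<^sup>+ x. of_bool (x \<noteq> y) \<partial>repair (?r xs) (?p xs) y \<partial>?r xs"
  let ?e = "\<lambda>x. 1 - overlap (marg (\<rho> ! j) (set (take (block_start L j) \<rho>)) x) (marg (\<rho> ! j) (set (take j \<rho>)) x)"
  have shift: "(\<integral>\<^sup>+ x. c + f x \<partial>measure_pmf p) = c + (\<integral>\<^sup>+ x. f x \<partial>measure_pmf p)"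
    for c :: ennreal and f and p :: "nat pmf"
    by (subst nn_integral_add) (auto simp: measure_pmf.emeasure_space_1)
  have m: "of_nat (mistakes (zs @ [(x, y)])) = (of_nat (mistakes zs) + of_bool (x \<noteq> y) :: ennreal)" for zs x y
    by (auto simp: mistakes_def)
  have "(\<integral>\<^sup>+ zs. of_nat (mistakes zs) \<partial>chain_law ?g L \<rho> (Suc j))
      = (\<integral>\<^sup>+ zs. of_nat (mistakes zs) + ?m (map fst zs) \<partial>chain_law ?g L \<rho> j)"
    by (simp only: chain_law.simps nn_integral_bind_pmf nn_integral_map_pmf m shift)
  also have "\<dots> = (\<integral>\<^sup>+ zs. of_nat (mistakes zs) \<partial>chain_law ?g L \<rho> j) + (\<integral>\<^sup>+ zs. ?m (map fst zs) \<partial>chain_law ?g L \<rho> j)"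
    by (rule nn_integral_add) auto
  finally have split: "(\<integral>\<^sup>+ zs. of_nat (mistakes zs) \<partial>chain_law ?g L \<rho> (Suc j))
      = (\<integral>\<^sup>+ zs. of_nat (mistakes zs) \<partial>chain_law ?g L \<rho> j) + (\<integral>\<^sup>+ zs. ?m (map fst zs) \<partial>chain_law ?g L \<rho> j)" .
  have "(\<integral>\<^sup>+ zs. ?m (map fst zs) \<partial>chain_law ?g L \<rho> j) = (\<integral>\<^sup>+ xs. ?m xs \<partial>map_pmf (map fst) (chain_law ?g L \<rho> j))"
    by simp
  also have "\<dots> = (\<integral>\<^sup>+ x. ?m (map x (take j \<rho>)) \<partial>\<mu>)"
    using j by (subst map_fst_chain_law[OF \<rho>]) auto
  also have "\<dots> \<le> (\<integral>\<^sup>+ x. ennreal (?e x) \<partial>\<mu>)"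
  proof (rule nn_integral_mono_AE, rule AE_pmfI)
    fix x assume x: "x \<in> set_pmf \<mu>"
    interpret finite_pmf_pair "marg (\<rho> ! j) (set (take (block_start L j) \<rho>)) x" "marg (\<rho> ! j) (set (take j \<rho>)) x" "{1..q}"
      by (rule marg_pair[OF x orders_nth[OF \<rho> j]])
    show "?m (map x (take j \<rho>)) \<le> ennreal (?e x)"
      unfolding guess_law_eq[OF x] true_law_eq[OF x] by (rule repair_mismatch)
  qed
  also have "\<dots> = ennreal (measure_pmf.expectation \<mu> ?e)"
  proof (rule nn_integral_eq_integral[OF integrable_law], rule AE_pmfI)
    fix x assume x: "x \<in> set_pmf \<mu>"
    interpret finite_pmf_pair "marg (\<rho> ! j) (set (take (block_start L j) \<rho>)) x" "marg (\<rho> ! j) (set (take j \<rho>)) x" "{1..q}"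
      by (rule marg_pair[OF x orders_nth[OF \<rho> j]])
    show "0 \<le> ?e x" using overlap_le_1 by simp
  qed
  finally show ?thesis unfolding split by (rule add_left_mono)
qed

lemma excess_nonneg:
  assumes \<rho>: "\<rho> \<in> orders" and j: "j < n"
  shows "0 \<le> measure_pmf.expectation \<mu> (\<lambda>x. 1 - overlap (marg (\<rho> ! j) S x) (marg (\<rho> ! j) T x))"
proof (rule integral_nonneg_AE, rule AE_pmfI)
  fix x assume x: "x \<in> set_pmf \<mu>"
  interpret finite_pmf_pair "marg (\<rho> ! j) S x" "marg (\<rho> ! j) T x" "{1..q}"
    by (rule marg_pair[OF x orders_nth[OF \<rho> j]])
  show "0 \<le> 1 - overlap (marg (\<rho> ! j) S x) (marg (\<rho> ! j) T x)" using overlap_le_1 by simp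
qed

lemma expected_mistakes_order:
  assumes \<rho>: "\<rho> \<in> orders" and "m \<le> n"
  shows "(\<integral>\<^sup>+ zs. of_nat (mistakes zs) \<partial>chain_law (cond_marg \<mu>) L \<rho> m)
    \<le> ennreal (\<Sum>j<m. measure_pmf.expectation \<mu> (\<lambda>x. 1 - overlap (marg (\<rho> ! j) (set (take (block_start L j) \<rho>)) x) (marg (\<rho> ! j) (set (take j \<rho>)) x)))"
  using assms(2)
proof (induction m)
  case 0
  show ?case by (simp add: mistakes_def)
next
  case (Suc m)
  have m: "m < n" using Suc by simp
  have "0 \<le> (\<Sum>j<m. measure_pmf.expectation \<mu> (\<lambda>x. 1 - overlap (marg (\<rho> ! j) (set (take (block_start L j) \<rho>)) x) (marg (\<rho> ! j) (set (take j \<rho>)) x)))"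
    using m by (intro sum_nonneg excess_nonneg[OF \<rho>]) auto
  from order_trans[OF expected_mistakes_step[OF \<rho> m, of L] add_right_mono[OF Suc.IH]] Suc.prems
    ennreal_plus[OF this excess_nonneg[OF \<rho> m], symmetric]
  show ?case
    by (simp only: sum.lessThan_Suc Suc_leD)
qed

lemma expected_mistakes_le:
  fixes \<epsilon> :: real and L :: nat
  assumes L: "L > 0" and \<epsilon>: "0 < \<epsilon>" and n: "n > 0" and q: "q > 0"
  shows "(\<integral>\<^sup>+ (\<rho>, zs). of_nat (mistakes zs) \<partial>bind_pmf (pmf_of_set orders) (\<lambda>\<rho>. map_pmf (Pair \<rho>) (chain_law (cond_marg \<mu>) L \<rho> n)))
    \<le> ennreal (4 * \<epsilon> * real n + real L * ln (real q) / (4 * \<epsilon>))"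
proof -
  let ?e = "\<lambda>\<rho>. \<Sum>j<n. measure_pmf.expectation \<mu> (\<lambda>x. 1 - overlap (marg (\<rho> ! j) (set (take (block_start L j) \<rho>)) x) (marg (\<rho> ! j) (set (take j \<rho>)) x))"
  have nn: "0 \<le> ?e \<rho>" if "\<rho> \<in> orders" for \<rho>
    using that by (intro sum_nonneg excess_nonneg) auto
  have c: "card orders > 0" using finite_orders orders_nonempty by (simp add: card_gt_0_iff)
  have "(\<integral>\<^sup>+ (\<rho>, zs). of_nat (mistakes zs) \<partial>bind_pmf (pmf_of_set orders) (\<lambda>\<rho>. map_pmf (Pair \<rho>) (chain_law (cond_marg \<mu>) L \<rho> n)))
     = (\<integral>\<^sup>+ \<rho>. \<integral>\<^sup>+ zs. of_nat (mistakes zs) \<partial>chain_law (cond_marg \<mu>) L \<rho> n \<partial>pmf_of_set orders)"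
    by (simp add: nn_integral_bind_pmf)
  also have "\<dots> \<le> (\<integral>\<^sup>+ \<rho>. ennreal (?e \<rho>) \<partial>pmf_of_set orders)"
    by (intro nn_integral_mono_AE AE_pmfI expected_mistakes_order)
      (auto simp: set_pmf_of_set[OF orders_nonempty finite_orders])
  also have "\<dots> = (\<Sum>\<rho>\<in>orders. ennreal (?e \<rho>)) / of_nat (card orders)"
    by (rule nn_integral_pmf_of_set[OF orders_nonempty finite_orders])
  also have "\<dots> = ennreal ((\<Sum>\<rho>\<in>orders. ?e \<rho>) / card orders)"
  proof -
    have "0 \<le> (\<Sum>\<rho>\<in>orders. ?e \<rho>)" by (rule sum_nonneg) (rule nn)
    moreover have "(\<Sum>\<rho>\<in>orders. ennreal (?e \<rho>)) = ennreal (\<Sum>\<rho>\<in>orders. ?e \<rho>)"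
      by (rule sum_ennreal) (rule nn)
    ultimately show ?thesis
      using c by (simp only: ennreal_of_nat_eq_real_of_nat) (rule divide_ennreal, auto)
  qed
  also have "\<dots> \<le> ennreal (4 * \<epsilon> * real n + real L * ln (real q) / (4 * \<epsilon>))"
    using expected_excess_sum_le[OF L \<epsilon> n q] c by (intro ennreal_leI) (simp add: field_simps)
  finally show ?thesis .
qed

end


section \<open>Progress of the rounds\<close>

definition block_end :: "nat \<Rightarrow> nat \<Rightarrow> nat \<Rightarrow> nat" where
  "block_end L n c = min n (L * (c div L) + L)"

text \<open>The exclusive end of the stretch made final by a verification round. The first bad
  position is included, since its repaired value is already exact.\<close>

definition next_pos :: "nat \<Rightarrow> nat \<Rightarrow> (nat \<Rightarrow> bool) \<Rightarrow> nat \<Rightarrow> nat" where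
  "next_pos L n bad c = (LEAST j. c < j \<and> (bad (j - 1) \<or> j = n \<or> L dvd j))"

text \<open>In \<open>(c, b)\<close>, the first \<open>c\<close> positions are final, and \<open>b\<close> tells whether the laws of the guesses for the rest of
  the current block are known. Verification stops after the first bad guess, which is repaired.\<close>

fun pos :: "nat \<Rightarrow> nat \<Rightarrow> (nat \<Rightarrow> bool) \<Rightarrow> nat \<Rightarrow> nat \<times> bool" where
  "pos L n bad 0 = (0, False)"
| "pos L n bad (Suc k) = (case pos L n bad k of (c, b) \<Rightarrow>
     if n \<le> c then (c, b) else if b then (let c' = next_pos L n bad c in (c', \<not> (L dvd c' \<or> c' = n)))
     else (c, True))"

lemma next_pos:
  assumes "c < n"
  shows "c < next_pos L n bad c" "next_pos L n bad c \<le> n"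
    "bad (next_pos L n bad c - 1) \<or> next_pos L n bad c = n \<or> L dvd next_pos L n bad c"
    "\<And>i. c \<le> i \<Longrightarrow> Suc i < next_pos L n bad c \<Longrightarrow> \<not> bad i"
proof -
  let ?P = "\<lambda>j. c < j \<and> (bad (j - 1) \<or> j = n \<or> L dvd j)"
  have n: "?P n" using assms by simp
  from LeastI[of ?P, OF n] show "c < next_pos L n bad c"
    "bad (next_pos L n bad c - 1) \<or> next_pos L n bad c = n \<or> L dvd next_pos L n bad c"
    by (auto simp: next_pos_def)
  show "next_pos L n bad c \<le> n" unfolding next_pos_def by (rule Least_le[of ?P, OF n])
  fix i assume i: "c \<le> i" "Suc i < next_pos L n bad c"
  from not_less_Least[of "Suc i" ?P] i show "\<not> bad i" unfolding next_pos_def by auto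
qed

lemma next_pos_le_block_end:
  assumes "c < n" "L > 0"
  shows "next_pos L n bad c \<le> block_end L n c"
proof -
  let ?P = "\<lambda>j. c < j \<and> (bad (j - 1) \<or> j = n \<or> L dvd j)"
  have "c mod L < L" using assms by simp
  then have "c < L * (c div L) + L" using mult_div_mod_eq[of L c] by linarith
  then have "?P (L * (c div L) + L)" by simp
  then have "next_pos L n bad c \<le> L * (c div L) + L" unfolding next_pos_def by (rule Least_le)
  then show ?thesis using next_pos(2)[OF assms(1)] by (simp add: block_end_def)
qed

text \<open>Beyond the first mistake a round works with a wrong prefix, and its mismatches there
  need not be those of the chain. The stopping position is unaffected, because it depends only on
  \<open>bad\<close> before itself.\<close>

lemma next_pos_cong:
  assumes "c < n" "\<And>j. c \<le> j \<Longrightarrow> j < next_pos L n bad c \<Longrightarrow> bad' j = bad j"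
  shows "next_pos L n bad' c = next_pos L n bad c"
proof -
  let ?c = "next_pos L n bad c"
  have e: "bad' (j - 1) = bad (j - 1)" if "c < j" "j \<le> ?c" for j
    using that by (intro assms(2)) auto
  show ?thesis
    unfolding next_pos_def[of L n bad']
  proof (rule Least_equality)
    show "c < ?c \<and> (bad' (?c - 1) \<or> ?c = n \<or> L dvd ?c)"
      using next_pos[OF assms(1), where L=L and bad=bad] e[of ?c] by auto
  next
    fix j assume j: "c < j \<and> (bad' (j - 1) \<or> j = n \<or> L dvd j)"
    show "?c \<le> j"
    proof (rule ccontr)
      assume "\<not> ?c \<le> j"
      then have "j < (LEAST j. c < j \<and> (bad (j - 1) \<or> j = n \<or> L dvd j))"
        by (simp add: next_pos_def)
      from not_less_Least[OF this] have "\<not> (c < j \<and> (bad (j - 1) \<or> j = n \<or> L dvd j))" .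
      with j e[of j] \<open>\<not> ?c \<le> j\<close> show False by linarith
    qed
  qed
qed

text \<open>A stop that is not at a multiple of \<open>L\<close> stays in the current block, so the
  guess laws already obtained remain the right ones.\<close>

lemma block_end_next_pos:
  assumes "c < n" "L > 0" "\<not> L dvd next_pos L n bad c"
  shows "block_end L n (next_pos L n bad c) = block_end L n c"
proof -
  let ?c = "next_pos L n bad c"
  have "?c \<le> L * (c div L) + L"
    using next_pos_le_block_end[OF assms(1,2), where bad=bad] by (simp add: block_end_def)
  moreover have "?c \<noteq> L * (c div L) + L" using assms(3) by auto
  ultimately have "?c < Suc (c div L) * L" by (simp add: mult.commute)
  then have "?c div L < Suc (c div L)" by (rule less_mult_imp_div_less)
  moreover have "c div L \<le> ?c div L" using next_pos(1)[OF assms(1)] by (intro div_le_mono) (simp add: less_imp_le)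
  ultimately have "?c div L = c div L" by simp
  then show ?thesis by (simp add: block_end_def)
qed

section \<open>A potential bounding the number of rounds\<close>

definition multiples_from :: "nat \<Rightarrow> nat \<Rightarrow> nat \<Rightarrow> nat" where
  "multiples_from L n c = card {m \<in> {c..<n}. L dvd m}"

definition bad_from :: "nat \<Rightarrow> (nat \<Rightarrow> bool) \<Rightarrow> nat \<Rightarrow> nat" where
  "bad_from n bad c = card {j \<in> {c..<n}. bad j}"

text \<open>An upper bound for the remaining rounds: one per bad position ahead, two per block not
  yet begun, and one to finish a block whose guess laws are known. \<open>Suc c\<close> avoids
  counting the start of that block again.\<close>

definition rank :: "nat \<Rightarrow> nat \<Rightarrow> (nat \<Rightarrow> bool) \<Rightarrow> nat \<times> bool \<Rightarrow> nat" where
  "rank L n bad = (\<lambda>(c, b). bad_from n bad c +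
     (if b then 1 + 2 * multiples_from L n (Suc c) else 2 * multiples_from L n c))"

lemma multiples_from_mono: "c \<le> c' \<Longrightarrow> multiples_from L n c' \<le> multiples_from L n c"
  unfolding multiples_from_def by (intro card_mono) auto

lemma bad_from_mono: "c \<le> c' \<Longrightarrow> bad_from n bad c' \<le> bad_from n bad c"
  unfolding bad_from_def by (intro card_mono) auto

lemma multiples_from_start: "c < n \<Longrightarrow> L dvd c \<Longrightarrow> multiples_from L n c = Suc (multiples_from L n (Suc c))"
proof -
  assume "c < n" "L dvd c"
  then have "{m \<in> {c..<n}. L dvd m} = insert c {m \<in> {Suc c..<n}. L dvd m}"
    by (auto simp: Suc_le_eq le_less)
  then show ?thesis by (simp add: multiples_from_def)
qed

lemma bad_from_less:
  assumes "c < c'" "c' \<le> n" "bad (c' - 1)"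
  shows "bad_from n bad c' < bad_from n bad c"
proof -
  have "c' - 1 \<in> {j \<in> {c..<n}. bad j}" "c' - 1 \<notin> {j \<in> {c'..<n}. bad j}"
    "{j \<in> {c'..<n}. bad j} \<subseteq> {j \<in> {c..<n}. bad j}"
    using assms by auto
  then have "{j \<in> {c'..<n}. bad j} \<subset> {j \<in> {c..<n}. bad j}" by blast
  then show ?thesis unfolding bad_from_def by (intro psubset_card_mono) simp_all
qed

text \<open>The flag is cleared only at a block boundary or at the end, so guess laws are always
  requested with exactly the prefix before the block.\<close>

lemma pos_aligned: "pos L n bad k = (c, b) \<Longrightarrow> c \<le> n \<and> (\<not> b \<longrightarrow> L dvd c \<or> c = n)"
proof (induction k arbitrary: c b)
  case (Suc k)
  obtain c0 b0 where p: "pos L n bad k = (c0, b0)" by force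
  show ?case
  proof (cases "n \<le> c0")
    case True then show ?thesis using Suc.prems Suc.IH[OF p] p by simp
  next
    case False
    then have "next_pos L n bad c0 \<le> n" by (intro next_pos(2)) simp
    then show ?thesis using Suc.prems Suc.IH[OF p] p False by (cases b0) (auto simp: Let_def)
  qed
qed auto

text \<open>A guessing round lowers the charge of its block from 2 to 1. A verification round either
  leaves the block and saves that 1, or stops inside it just after a bad position, which is then no
  longer counted.\<close>

lemma rank_decreases:
  assumes p: "pos L n bad k = (c, b)" and c: "c < n"
  shows "rank L n bad (pos L n bad (Suc k)) < rank L n bad (pos L n bad k)"
proof (cases b)
  case False
  then have "L dvd c" using pos_aligned[OF p] c by auto
  then show ?thesis using p c False by (simp add: rank_def multiples_from_start)
next
  case True
  let ?c = "next_pos L n bad c"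
  note np = next_pos[OF c, where L=L and bad=bad]
  have m: "multiples_from L n ?c \<le> multiples_from L n (Suc c)" "multiples_from L n (Suc ?c) \<le> multiples_from L n (Suc c)"
    "bad_from n bad ?c \<le> bad_from n bad c"
    using np by (auto intro!: multiples_from_mono bad_from_mono)
  show ?thesis
  proof (cases "L dvd ?c \<or> ?c = n")
    case t: True
    then show ?thesis using p c True m by (auto simp: rank_def Let_def)
  next
    case False
    then have "bad_from n bad ?c < bad_from n bad c" using np by (intro bad_from_less) auto
    then show ?thesis using p c True m False by (auto simp: rank_def Let_def)
  qed
qed

lemma pos_terminates: "\<exists>k \<le> rank L n bad (0, False). n \<le> fst (pos L n bad k)"
proof (rule ccontr)
  assume *: "\<not> ?thesis"
  have "k \<le> Suc (rank L n bad (0, False)) \<Longrightarrow> k + rank L n bad (pos L n bad k) \<le> rank L n bad (0, False)" for k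
  proof (induction k)
    case (Suc k)
    obtain c b where p: "pos L n bad k = (c, b)" by force
    have "k \<le> rank L n bad (0, False)" using Suc.prems by simp
    with * have "\<not> n \<le> fst (pos L n bad k)" by blast
    then have "c < n" using p by simp
    from rank_decreases[OF p this] Suc.IH \<open>k \<le> _\<close> show ?case by linarith
  qed simp
  from this[of "Suc (rank L n bad (0, False))"] show False by simp
qed

definition num_steps :: "nat \<Rightarrow> nat \<Rightarrow> (nat \<Rightarrow> bool) \<Rightarrow> nat" where
  "num_steps L n bad = (LEAST k. n \<le> fst (pos L n bad k))"

lemma multiples_le: "L > 0 \<Longrightarrow> multiples_from L n 0 \<le> Suc (n div L)"
proof -
  assume L: "L > 0"
  have "{m \<in> {0..<n}. L dvd m} \<subseteq> (\<lambda>i. L * i) ` {..n div L}"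
  proof
    fix m assume "m \<in> {m \<in> {0..<n}. L dvd m}"
    then have "m = L * (m div L)" "m div L \<le> n div L" by (auto intro: div_le_mono)
    then show "m \<in> (\<lambda>i. L * i) ` {..n div L}" by blast
  qed
  then have "multiples_from L n 0 \<le> card ((\<lambda>i. L * i) ` {..n div L})"
    unfolding multiples_from_def by (intro card_mono) auto
  also have "\<dots> \<le> Suc (n div L)" using card_image_le[of "{..n div L}" "\<lambda>i. L * i"] by simp
  finally show ?thesis .
qed

lemma num_steps_le:
  assumes "L > 0"
  shows "num_steps L n bad \<le> bad_from n bad 0 + 2 * Suc (n div L)"
proof -
  obtain k where k: "k \<le> rank L n bad (0, False)" "n \<le> fst (pos L n bad k)"
    using pos_terminates by blast
  have "num_steps L n bad \<le> k" unfolding num_steps_def using k(2) by (rule Least_le)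
  with k(1) multiples_le[OF assms, of n] show ?thesis by (simp add: rank_def)
qed

lemma pos_final: "n \<le> fst (pos L n bad k) \<longleftrightarrow> num_steps L n bad \<le> k"
proof
  show "n \<le> fst (pos L n bad k) \<Longrightarrow> num_steps L n bad \<le> k"
    unfolding num_steps_def by (rule Least_le)
  have "n \<le> fst (pos L n bad (num_steps L n bad + i))" for i
  proof (induction i)
    case 0
    have "\<exists>k. n \<le> fst (pos L n bad k)" using pos_terminates by blast
    from LeastI_ex[OF this] show ?case by (simp add: num_steps_def)
  qed (auto split: prod.split)
  from this[of "k - num_steps L n bad"] show "num_steps L n bad \<le> k \<Longrightarrow> n \<le> fst (pos L n bad k)" by simp
qed


section \<open>The algorithm\<close>

text \<open>The components \<open>c\<close> and \<open>b\<close> of a state \<open>(c, b, xs, R)\<close> are as in \<^const>\<open>pos\<close>; \<open>xs\<close> are the final values, and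
  \<open>R\<close> are the laws of the guesses, meaningful only if \<open>b\<close> holds and within the current block.\<close>

type_synonym state = "nat \<times> bool \<times> nat list \<times> (nat \<Rightarrow> nat pmf)"

text \<open>The coin block is fixed by the position, so later rounds on the same block see the same
  guesses, as in \<open>chain\<close>.\<close>

definition guesses :: "(nat \<Rightarrow> bool) \<Rightarrow> (nat \<Rightarrow> nat pmf) \<Rightarrow> nat \<Rightarrow> nat" where
  "guesses \<omega> R j = sampler (R j) (coin_block (2 * j + 1) \<omega>)"

text \<open>In a verification round \<open>x j\<close> is formally defined for every
  \<open>j\<close>, but is trustworthy only before \<open>c'\<close>: later entries may rest on a
  wrong guess or on a query that was not asked, and they are discarded.\<close>

definition advance :: "nat \<Rightarrow> nat \<Rightarrow> nat list \<Rightarrow> (nat \<Rightarrow> bool) \<Rightarrow> state \<Rightarrow> (query \<Rightarrow> answer option) \<Rightarrow> state" where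
  "advance L n \<rho> \<omega> = (\<lambda>(c, b, xs, R) f.
     if b then
       (let y = guesses \<omega> R;
          x = (\<lambda>j. sampler (repair (R j) (law_of (the (f (prefix_query \<rho> j (xs @ map y [c..<j]))))) (y j)) (coin_block (2 * j + 2) \<omega>));
          c' = next_pos L n (\<lambda>j. x j \<noteq> y j) c
        in (c', \<not> (L dvd c' \<or> c' = n), xs @ map x [c..<c'], R))
     else (c, True, xs, \<lambda>j. law_of (the (f (prefix_query \<rho> j xs)))))"

definition queries :: "nat \<Rightarrow> nat \<Rightarrow> nat list \<Rightarrow> (nat \<Rightarrow> bool) \<Rightarrow> state \<Rightarrow> query set" where
  "queries L n \<rho> \<omega> = (\<lambda>(c, b, xs, R).
     (\<lambda>j. prefix_query \<rho> j (if b then xs @ map (guesses \<omega> R) [c..<j] else xs)) ` {c..<block_end L n c})"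

definition initial :: state where
  "initial = (0, False, [], \<lambda>_. undefined)"

fun machine :: "nat \<Rightarrow> nat \<Rightarrow> nat list \<Rightarrow> (nat \<Rightarrow> bool) \<Rightarrow> (query \<Rightarrow> answer) \<Rightarrow> nat \<Rightarrow> state" where
  "machine L n \<rho> \<omega> g 0 = initial"
| "machine L n \<rho> \<omega> g (Suc k) = (let s = machine L n \<rho> \<omega> g k in
     if n \<le> fst s then s
     else advance L n \<rho> \<omega> s (\<lambda>Q. if Q \<in> queries L n \<rho> \<omega> s then Some (g Q) else None))"

section \<open>Agreement of the rounds with the sequential chain\<close>

lemma take_chain: "j \<le> m \<Longrightarrow> take j (chain g L \<rho> \<omega> m) = chain g L \<rho> \<omega> j"
proof (induction m)
  case (Suc m)
  then show ?case by (cases "j = Suc m") (auto simp: Let_def)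
qed simp

definition mismatch :: "(nat \<times> nat) list \<Rightarrow> nat \<Rightarrow> bool" where
  "mismatch zs j \<longleftrightarrow> fst (zs ! j) \<noteq> snd (zs ! j)"

lemma bad_from_mismatch: "bad_from (length zs) (mismatch zs) 0 = mistakes zs"
  unfolding bad_from_def mistakes_def length_filter_conv_card
  by (auto intro!: arg_cong[where f=card] simp: mismatch_def split: prod.splits) (metis prod.collapse)+

lemma chain_nth:
  fixes g :: "query \<Rightarrow> answer" and L n :: nat and \<rho> :: "nat list" and \<omega> :: "nat \<Rightarrow> bool"
  assumes "j < n"
  defines "zs \<equiv> chain g L \<rho> \<omega> n"
  shows "snd (zs ! j) = sampler (guess_law g L \<rho> (take j (map fst zs)) j) (coin_block (2 * j + 1) \<omega>)"
    "fst (zs ! j) = sampler (repair (guess_law g L \<rho> (take j (map fst zs)) j) (true_law g \<rho> (take j (map fst zs)) j) (snd (zs ! j))) (coin_block (2 * j + 2) \<omega>)"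
proof -
  have "zs ! j = chain g L \<rho> \<omega> (Suc j) ! j"
    using assms take_chain[of "Suc j" n g L \<rho> \<omega>] by (metis Suc_leI lessI nth_take)
  moreover have "take j (map fst zs) = map fst (chain g L \<rho> \<omega> j)"
    using assms take_chain[of j n g L \<rho> \<omega>] by (simp add: take_map)
  ultimately show "snd (zs ! j) = sampler (guess_law g L \<rho> (take j (map fst zs)) j) (coin_block (2 * j + 1) \<omega>)"
    "fst (zs ! j) = sampler (repair (guess_law g L \<rho> (take j (map fst zs)) j) (true_law g \<rho> (take j (map fst zs)) j) (snd (zs ! j))) (coin_block (2 * j + 2) \<omega>)"
    by (auto simp: Let_def nth_append)
qed

lemma take_upt_map: "c \<le> j \<Longrightarrow> j \<le> length xs \<Longrightarrow> take c xs @ map (\<lambda>i. xs ! i) [c..<j] = take j xs"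
  by (rule nth_equalityI) (auto simp: nth_append)

text \<open>Up to and including the first mismatch, the guessed prefix equals the true one, so
  verification makes the same queries and, with the same coins, the same draws as the chain. The
  control flow is thus \<open>pos\<close> run on the chain's own mismatches.\<close>

lemma machine_invariant:
  fixes g :: "query \<Rightarrow> answer" and L n :: nat and \<rho> :: "nat list" and \<omega> :: "nat \<Rightarrow> bool"
  assumes L: "L > 0"
  defines "zs \<equiv> chain g L \<rho> \<omega> n"
  defines "xs \<equiv> map fst zs"
  shows "\<exists>R. machine L n \<rho> \<omega> g k = (fst (pos L n (mismatch zs) k), snd (pos L n (mismatch zs) k), take (fst (pos L n (mismatch zs) k)) xs, R)
    \<and> (snd (pos L n (mismatch zs) k) \<longrightarrow> (\<forall>j\<in>{fst (pos L n (mismatch zs) k)..<block_end L n (fst (pos L n (mismatch zs) k))}.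
        R j = guess_law g L \<rho> (take j xs) j))"
proof (induction k)
  case 0
  show ?case by (simp add: initial_def)
next
  case (Suc k)
  have len: "length zs = n" "length xs = n" by (auto simp: zs_def xs_def)
  obtain c b where p: "pos L n (mismatch zs) k = (c, b)" by force
  with Suc obtain R where st: "machine L n \<rho> \<omega> g k = (c, b, take c xs, R)"
    and R: "b \<Longrightarrow> j \<in> {c..<block_end L n c} \<Longrightarrow> R j = guess_law g L \<rho> (take j xs) j" for j
    by auto
  show ?case
  proof (cases "n \<le> c")
    case True
    then show ?thesis using p st R by auto
  next
    case False
    then have c: "c < n" by simp
    let ?f = "\<lambda>Q. if Q \<in> queries L n \<rho> \<omega> (c, b, take c xs, R) then Some (g Q) else None"
    show ?thesis
    proof (cases b)
      case b: False
      then have "L dvd c" using pos_aligned[OF p] c by auto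
      have "law_of (the (?f (prefix_query \<rho> j (take c xs)))) = guess_law g L \<rho> (take j xs) j"
        if j: "j \<in> {c..<block_end L n c}" for j
      proof -
        have "prefix_query \<rho> j (take c xs) \<in> queries L n \<rho> \<omega> (c, b, take c xs, R)"
          using j b by (auto simp: queries_def)
        \<comment> \<open>\<open>c\<close> starts the block containing \<open>j\<close>, so the
          known prefix is exactly what the guess law at \<open>j\<close> conditions on.\<close>
        moreover have "c div L = j div L"
        proof -
          obtain m where m: "c = L * m" using \<open>L dvd c\<close> by (auto elim: dvdE)
          then have "L * m \<le> j" "j < L * m + L" using j L by (auto simp: block_end_def)
          then have "j div L = m" using L
            by (metis add.commute div_nat_eqI mult.commute mult_Suc_right)
          then show ?thesis using m L by simp
        qed
        then have "take (L * (j div L)) (take j xs) = take c xs"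
          using \<open>L dvd c\<close> j by (metis atLeastLessThan_iff dvd_mult_div_cancel min.absorb1 take_take)
        ultimately show ?thesis by (simp add: guess_law_def)
      qed
      then show ?thesis using st p b c by (auto simp: advance_def)
    next
      case b: True
      let ?y = "guesses \<omega> R"
      let ?x = "\<lambda>j. sampler (repair (R j) (law_of (the (?f (prefix_query \<rho> j (take c xs @ map ?y [c..<j]))))) (?y j)) (coin_block (2 * j + 2) \<omega>)"
      let ?c = "next_pos L n (mismatch zs) c"
      note np = next_pos[OF c, where L=L and bad="mismatch zs"]
      have ce: "?c \<le> block_end L n c" by (rule next_pos_le_block_end[OF c L])
      have be: "block_end L n c \<le> n" by (simp add: block_end_def)
      have y: "?y j = snd (zs ! j)" if "j \<in> {c..<block_end L n c}" for j
        using R[OF b that] that be chain_nth(1)[of j n g L \<rho> \<omega>] by (simp add: guesses_def zs_def xs_def)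
      have x: "?x j = fst (zs ! j)" if j: "j \<in> {c..<?c}" for j
      proof -
        \<comment> \<open>Positions \<open>i < j < ?c\<close> are not the last of the stretch, so
          none of them is a mismatch and each guess is already the final value.\<close>
        have guessed: "map ?y [c..<j] = map (\<lambda>i. xs ! i) [c..<j]"
        proof (rule map_cong[OF refl])
          fix i assume i: "i \<in> set [c..<j]"
          then have "\<not> mismatch zs i" using j by (intro np(4)) auto
          then show "?y i = xs ! i" using y[of i] i j ce np(2) len by (auto simp: mismatch_def xs_def)
        qed
        have pre: "take c xs @ map ?y [c..<j] = take j xs"
          unfolding guessed using j np(2) len by (intro take_upt_map) auto
        have "prefix_query \<rho> j (take c xs @ map ?y [c..<j]) \<in> queries L n \<rho> \<omega> (c, b, take c xs, R)"
          unfolding queries_def using b j ce by (auto intro!: image_eqI[of _ _ j])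
        then have "law_of (the (?f (prefix_query \<rho> j (take c xs @ map ?y [c..<j])))) = true_law g \<rho> (take j xs) j"
          by (simp add: true_law_def pre)
        then show ?thesis
          using j ce np(2) y[of j] R[OF b, of j] chain_nth(2)[of j n g L \<rho> \<omega>] by (simp add: zs_def xs_def)
      qed
      \<comment> \<open>The round's own mismatch test is known to agree with that of the chain only
        before \<open>?c\<close>, which suffices by \<open>next_pos_cong\<close>.\<close>
      have nc: "next_pos L n (\<lambda>j. ?x j \<noteq> ?y j) c = ?c"
        using x y ce by (intro next_pos_cong c) (auto simp: mismatch_def)
      have sampled: "map ?x [c..<?c] = map (\<lambda>i. xs ! i) [c..<?c]"
        using x np(2) len by (intro map_cong refl) (auto simp: xs_def)
      have xs': "take c xs @ map ?x [c..<?c] = take ?c xs"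
        unfolding sampled using np(1,2) len by (intro take_upt_map) auto
      have adv: "advance L n \<rho> \<omega> (c, b, take c xs, R) ?f = (?c, \<not> (L dvd ?c \<or> ?c = n), take ?c xs, R)"
        unfolding advance_def prod.case Let_def if_P[OF b] nc xs' by (rule refl)
      have m: "machine L n \<rho> \<omega> g (Suc k) = (?c, \<not> (L dvd ?c \<or> ?c = n), take ?c xs, R)"
        using st c adv by simp
      have pp: "pos L n (mismatch zs) (Suc k) = (?c, \<not> (L dvd ?c \<or> ?c = n))"
        using p b c by (simp add: Let_def)
      have "\<not> (L dvd ?c \<or> ?c = n) \<Longrightarrow> j \<in> {?c..<block_end L n ?c} \<Longrightarrow> R j = guess_law g L \<rho> (take j xs) j" for j
        using block_end_next_pos[OF c L] np(1) by (intro R[OF b]) auto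
      then show ?thesis unfolding m pp by auto
    qed
  qed
qed

text \<open>The query set expressed through the order and the chain alone, without the coins; query
  counts thereby become functions of a discrete random variable.\<close>

definition round_queries :: "nat \<Rightarrow> nat \<Rightarrow> nat list \<Rightarrow> (nat \<times> nat) list \<Rightarrow> nat \<Rightarrow> query set" where
  "round_queries L n \<rho> zs k = (case pos L n (mismatch zs) k of (c, b) \<Rightarrow>
     (\<lambda>j. prefix_query \<rho> j (take c (map fst zs) @ (if b then map (\<lambda>i. snd (zs ! i)) [c..<j] else []))) ` {c..<block_end L n c})"

lemma queries_machine:
  fixes g :: "query \<Rightarrow> answer" and L n :: nat and \<rho> :: "nat list" and \<omega> :: "nat \<Rightarrow> bool"
  assumes L: "L > 0"
  defines "zs \<equiv> chain g L \<rho> \<omega> n"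
  shows "queries L n \<rho> \<omega> (machine L n \<rho> \<omega> g k) = round_queries L n \<rho> zs k"
proof -
  obtain c b where p: "pos L n (mismatch zs) k = (c, b)" by force
  with machine_invariant[OF L, of n \<rho> \<omega> g k] obtain R where
    st: "machine L n \<rho> \<omega> g k = (c, b, take c (map fst zs), R)"
    and R: "b \<Longrightarrow> j \<in> {c..<block_end L n c} \<Longrightarrow> R j = guess_law g L \<rho> (take j (map fst zs)) j" for j
    unfolding zs_def by auto
  have y: "guesses \<omega> R j = snd (zs ! j)" if "b" "j \<in> {c..<block_end L n c}" for j
    using R[OF that] that chain_nth(1)[of j n g L \<rho> \<omega>] by (simp add: guesses_def zs_def block_end_def)
  show ?thesis
    unfolding st queries_def round_queries_def p prod.case
  proof (rule image_cong[OF refl])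
    fix j assume j: "j \<in> {c..<block_end L n c}"
    have "map (guesses \<omega> R) [c..<j] = map (\<lambda>i. snd (zs ! i)) [c..<j]" if b
      using that y j by (intro map_cong refl) auto
    from arg_cong[OF this, of "\<lambda>ys. prefix_query \<rho> j (take c (map fst zs) @ ys)"]
    show "prefix_query \<rho> j (if b then take c (map fst zs) @ map (guesses \<omega> R) [c..<j] else take c (map fst zs))
      = prefix_query \<rho> j (take c (map fst zs) @ (if b then map (\<lambda>i. snd (zs ! i)) [c..<j] else []))"
      by (cases b) (simp_all del: map_eq_conv)
  qed
qed

lemma card_round_queries: "L > 0 \<Longrightarrow> finite (round_queries L n \<rho> zs k) \<and> card (round_queries L n \<rho> zs k) \<le> L"
proof -
  assume L: "L > 0"
  obtain c b where p: "pos L n (mismatch zs) k = (c, b)" by force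
  have "card (round_queries L n \<rho> zs k) \<le> card {c..<block_end L n c}"
    unfolding round_queries_def p prod.case by (rule card_image_le) simp
  also have "\<dots> \<le> L"
  proof -
    have "L * (c div L) \<le> c" "block_end L n c \<le> L * (c div L) + L" by (simp_all add: block_end_def)
    then have "block_end L n c - c \<le> L" by linarith
    then show ?thesis by simp
  qed
  finally show ?thesis by (simp add: round_queries_def p)
qed

section \<open>The algorithm as a function of the transcript\<close>

definition assemble :: "nat \<Rightarrow> nat list \<Rightarrow> nat list \<Rightarrow> nat \<Rightarrow> nat" where
  "assemble n \<rho> xs = restrict (assignment \<rho> xs) {1..n}"

text \<open>An algorithm sees only its coins and the transcript, so it recovers its state by
  replaying all earlier rounds.\<close>

definition block_sampler :: "(nat \<Rightarrow> nat \<Rightarrow> nat) \<Rightarrow> algorithm" where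
  "block_sampler len n q \<omega> h = (let \<rho> = random_order n \<omega>; s = foldl (advance (len n q) n \<rho> \<omega>) initial h in
     if n \<le> fst s then Inr (assemble n \<rho> (fst (snd (snd s)))) else Inl (queries (len n q) n \<rho> \<omega> s))"

lemma foldl_transcript:
  "foldl (advance (len n q) n (random_order n \<omega>) \<omega>) initial (transcript_after (block_sampler len) n q g \<omega> k)
    = machine (len n q) n (random_order n \<omega>) \<omega> g k"
  by (induction k) (auto simp: Let_def block_sampler_def)

context
  fixes len :: "nat \<Rightarrow> nat \<Rightarrow> nat" and n q :: nat and g :: "query \<Rightarrow> answer" and \<omega> :: "nat \<Rightarrow> bool"
    and L \<rho> zs
  assumes len: "len n q > 0"
  defines "L \<equiv> len n q" and "\<rho> \<equiv> random_order n \<omega>" and "zs \<equiv> chain g (len n q) (random_order n \<omega>) \<omega> n"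
begin

lemma block_sampler_at: "block_sampler len n q \<omega> (transcript_after (block_sampler len) n q g \<omega> k) =
  (if num_steps L n (mismatch zs) \<le> k then Inr (assemble n \<rho> (map fst zs)) else Inl (round_queries L n \<rho> zs k))"
proof -
  obtain c b where p: "pos L n (mismatch zs) k = (c, b)" by force
  with machine_invariant[OF len, of n \<rho> \<omega> g k] obtain R where
    st: "machine L n \<rho> \<omega> g k = (c, b, take c (map fst zs), R)"
    unfolding zs_def \<rho>_def L_def by auto
  have "n \<le> c \<longleftrightarrow> num_steps L n (mismatch zs) \<le> k" using pos_final[of n L "mismatch zs" k] p by simp
  moreover have "n \<le> c \<Longrightarrow> take c (map fst zs) = map fst zs" by (simp add: zs_def)
  moreover have "queries L n \<rho> \<omega> (machine L n \<rho> \<omega> g k) = round_queries L n \<rho> zs k"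
    unfolding L_def \<rho>_def zs_def by (rule queries_machine[OF len])
  ultimately show ?thesis
    using st by (simp add: block_sampler_def foldl_transcript L_def \<rho>_def)
qed

lemma halted_block_sampler: "halted (block_sampler len) n q g \<omega> k \<longleftrightarrow> num_steps L n (mismatch zs) \<le> k"
  unfolding halted_def block_sampler_at by simp

lemma Least_halted: "(LEAST k. halted (block_sampler len) n q g \<omega> k) = num_steps L n (mismatch zs)"
  unfolding halted_block_sampler by (rule Least_equality) auto

lemma num_rounds_block_sampler: "num_rounds (block_sampler len) n q g \<omega> = of_nat (num_steps L n (mismatch zs))"
  unfolding num_rounds_def Least_halted by (auto simp: halted_block_sampler)

lemma alg_output_block_sampler: "alg_output (block_sampler len) n q g \<omega> = Some (assemble n \<rho> (map fst zs))"
  unfolding alg_output_def Least_halted block_sampler_at by (auto simp: halted_block_sampler)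

lemma num_queries_block_sampler:
  "num_queries (block_sampler len) n q g \<omega> = (\<Sum>k<num_steps L n (mismatch zs). of_nat (card (round_queries L n \<rho> zs k)))"
  unfolding num_queries_def block_sampler_at
  using card_round_queries[of L n \<rho> zs] len by (subst suminf_finite[of "{..<num_steps L n (mismatch zs)}"]) (auto simp: qcount_def L_def intro!: sum.cong)

end


section \<open>The choice of the block length\<close>

text \<open>Balances the number of blocks, of order \<open>n / L\<close>, against the entropy term
  of order \<open>L^2 * ln q\<close>. The maximum with 1 takes over when
  \<open>n < ln q\<close>.\<close>

definition block_length :: "nat \<Rightarrow> nat \<Rightarrow> nat" where
  "block_length n q = max 1 (nat \<lfloor>(real n / ln (real q)) powr (1/3)\<rfloor>)"

lemma block_length_pos: "block_length n q > 0"
  by (simp add: block_length_def)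

lemma ln_ge_half: "2 \<le> m \<Longrightarrow> 1/2 \<le> ln (real m)"
proof -
  assume "2 \<le> m"
  then have "ln 2 \<le> ln (real m)" by (subst ln_le_cancel_iff) auto
  moreover have "ln (1/2 :: real) \<le> 1/2 - 1" by (rule ln_le_minus_one) simp
  ultimately show ?thesis by (simp add: ln_div)
qed

text \<open>The term \<open>m\<close> bounds the expected number of mistakes: trivially by \<open>n\<close>, or by the
  entropy estimate for blocks of length \<open>L\<close> with \<open>\<epsilon> = 1 / L\<close>.\<close>

lemma block_length_tradeoff:
  assumes n: "n \<ge> 2" and q: "q \<ge> 2"
  defines "L \<equiv> real (block_length n q)" and "W \<equiv> real n powr (2/3) * ln (real q) powr (1/3)"
  shows "\<exists>m \<in> {real n, 4 * real n / L + L\<^sup>2 * ln (real q) / 4}.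
    m + 2 * (real n / L + 1) \<le> 17 * W \<and> L * (m + 2 * (real n / L + 1)) \<le> 11 * real n"
proof -
  define l where "l = ln (real q)"
  have l: "l \<ge> 1/2" unfolding l_def using q by (rule ln_ge_half)
  have n0: "real n \<ge> 2" using n by simp
  define s where "s = (real n / l) powr (1/3)"
  have L: "L = max 1 (real (nat \<lfloor>s\<rfloor>))" by (simp add: L_def block_length_def s_def l_def)
  have s0: "s > 0" using n0 l by (simp add: s_def)
  have s3: "s ^ 3 * l = real n"
  proof -
    have "s ^ 3 = s powr 3" using s0 by (simp add: powr_numeral)
    also have "\<dots> = real n / l" using n0 l by (simp add: s_def powr_powr)
    finally show ?thesis using l by simp
  qed
  have W: "W = s\<^sup>2 * l"
  proof -
    have "s\<^sup>2 = s powr 2" using s0 by (simp add: powr_numeral)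
    also have "\<dots> = (real n / l) powr (2/3)" by (simp add: s_def powr_powr)
    also have "\<dots> = real n powr (2/3) / l powr (2/3)" using n0 l by (simp add: powr_divide)
    finally have "s\<^sup>2 * l = real n powr (2/3) * (l powr 1 / l powr (2/3))" using l by simp
    also have "l powr 1 / l powr (2/3) = l powr (1/3)" by (simp only: powr_diff[symmetric]) simp
    finally show ?thesis by (simp add: W_def l_def)
  qed
  show ?thesis
  proof (cases "s < 1")
    case True
    \<comment> \<open>With \<open>L = 1\<close> and \<open>real n \<le> W\<close>, the trivial bound
      \<open>m = n\<close> is enough.\<close>
    then have "\<lfloor>s\<rfloor> \<le> 0" by linarith
    then have L1: "L = 1" by (simp add: L)
    have "s ^ 3 * l \<le> s\<^sup>2 * l"
      using True s0 l by (intro mult_right_mono) (auto simp: power3_eq_cube power2_eq_square mult_left_le)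
    then have "real n \<le> W" by (simp add: s3 W)
    then show ?thesis using n0 by (simp add: L1)
  next
    case False
    then have f: "\<lfloor>s\<rfloor> \<ge> 1" by linarith
    then have "L = of_int \<lfloor>s\<rfloor>" by (simp add: L)
    \<comment> \<open>Rounding down a number that is at least 1 loses at most a factor 2.\<close>
    then have L1: "1 \<le> L" and Ls: "L \<le> s" and sL: "s \<le> 2 * L" using f by linarith+
    have nL: "real n / L \<le> 2 * W"
    proof -
      have "real n = W * s" by (simp add: s3[symmetric] W power3_eq_cube power2_eq_square)
      also have "\<dots> \<le> W * (2 * L)" using sL l by (intro mult_left_mono) (auto simp: W)
      finally show ?thesis using L1 by (simp add: field_simps)
    qed
    have LW: "L\<^sup>2 * l \<le> W" unfolding W using Ls L1 l by (intro mult_right_mono power_mono) auto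
    have Ln: "L ^ 3 * l \<le> real n" unfolding s3[symmetric] using Ls L1 l by (intro mult_right_mono power_mono) auto
    have "1 * (1/2) \<le> W" unfolding W using False l by (intro mult_mono) (auto intro: one_le_power)
    then have W1: "1/2 \<le> W" by simp
    let ?m = "4 * real n / L + L\<^sup>2 * l / 4"
    have "L * 1 \<le> L * L\<^sup>2" using L1 by (intro mult_left_mono) (auto intro: one_le_power)
    then have "L \<le> L ^ 3" by (simp add: power3_eq_cube power2_eq_square)
    then have "L * (1/2) \<le> L ^ 3 * l" using l L1 by (intro mult_mono) auto
    with Ln have L2: "L \<le> 2 * real n" by linarith
    \<comment> \<open>The three terms are at most \<open>6 * n\<close>, \<open>n / 4\<close> and
      \<open>4 * n\<close>.\<close>
    have "L * (?m + 2 * (real n / L + 1)) = 6 * real n + L ^ 3 * l / 4 + 2 * L"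
      using L1 by (simp add: field_simps power3_eq_cube power2_eq_square)
    also have "\<dots> \<le> 11 * real n" using Ln L2 by linarith
    finally have "L * (?m + 2 * (real n / L + 1)) \<le> 11 * real n" .
    \<comment> \<open>The terms are at most \<open>8 * W\<close>, \<open>W / 4\<close>,
      \<open>4 * W\<close> and, as \<open>1/2 \<le> W\<close>, again \<open>4 * W\<close>.\<close>
    moreover have "?m + 2 * (real n / L + 1) \<le> 17 * W" using nL LW W1 by simp
    ultimately show ?thesis unfolding l_def by auto
  qed
qed

text \<open>The bound proved is below both terms of the minimum up to a constant: the first has the
  extra factor \<open>(ln n * ln q) powr (2/3)\<close>, at least 1/4 since both logarithms are at
  least 1/2; the second has the extra factor \<open>q powr (1/3)\<close>, at least 1.\<close>

lemma rounds_target: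
  assumes n: "n \<ge> 2" and q: "q \<ge> 2"
  shows "real n powr (2/3) * ln (real q) powr (1/3)
    \<le> 4 * (real n powr (2/3) * min (ln (real n) powr (2/3) * ln (real q)) (real q powr (1/3) * ln (real q) powr (1/3)))"
proof -
  have ln: "ln (real n) \<ge> 1/2" "ln (real q) \<ge> 1/2" using ln_ge_half[OF n] ln_ge_half[OF q] .
  have "1/4 = ((1/2) powr 2 :: real)" by (simp add: powr_numeral power2_eq_square)
  also have "\<dots> \<le> (1/2) powr (4/3)" by (rule powr_mono') auto
  also have "\<dots> = (1/2) powr (2/3) * (1/2) powr (2/3)" by (simp add: powr_add[symmetric])
  also have "\<dots> \<le> ln (real n) powr (2/3) * ln (real q) powr (2/3)"
    using ln by (intro mult_mono powr_mono2) auto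
  finally have a: "1 \<le> 4 * (ln (real n) powr (2/3) * ln (real q) powr (2/3))" by simp
  have "ln (real q) powr (1/3) * 1 \<le> ln (real q) powr (1/3) * (4 * (ln (real n) powr (2/3) * ln (real q) powr (2/3)))"
    using a by (intro mult_left_mono) auto
  also have "\<dots> = 4 * (ln (real n) powr (2/3) * (ln (real q) powr (1/3) * ln (real q) powr (2/3)))" by simp
  also have "ln (real q) powr (1/3) * ln (real q) powr (2/3) = ln (real q)"
    using ln by (simp add: powr_add[symmetric])
  finally have 1: "ln (real q) powr (1/3) \<le> 4 * (ln (real n) powr (2/3) * ln (real q))" by simp
  have "1 \<le> real q powr (1/3)" using q by (intro ge_one_powr_ge_zero) auto
  then have "1 * ln (real q) powr (1/3) \<le> 4 * real q powr (1/3) * ln (real q) powr (1/3)"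
    by (intro mult_right_mono) auto
  then have 2: "ln (real q) powr (1/3) \<le> 4 * (real q powr (1/3) * ln (real q) powr (1/3))" by simp
  have "ln (real q) powr (1/3) \<le> 4 * min (ln (real n) powr (2/3) * ln (real q)) (real q powr (1/3) * ln (real q) powr (1/3))"
    using 1 2 by (simp add: min_def)
  from mult_left_mono[OF this, of "real n powr (2/3)"] show ?thesis by (simp only: mult_ac) simp
qed

section \<open>Output law and expected costs of the algorithm\<close>

locale sampling_run = spin_law +
  assumes n2: "n \<ge> 2" and q2: "q \<ge> 2"
begin

abbreviation L :: nat where "L \<equiv> block_length n q"
abbreviation alg :: algorithm where "alg \<equiv> block_sampler block_length"
abbreviation rounds :: "(nat \<Rightarrow> bool) \<Rightarrow> ennreal" where "rounds \<equiv> num_rounds alg n q (cond_marg \<mu>)"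

definition history :: "(nat \<Rightarrow> bool) \<Rightarrow> nat list \<times> (nat \<times> nat) list" where
  "history \<omega> = (random_order n \<omega>, chain (cond_marg \<mu>) L (random_order n \<omega>) \<omega> n)"

definition history_law :: "(nat list \<times> (nat \<times> nat) list) pmf" where
  "history_law = bind_pmf (pmf_of_set orders) (\<lambda>\<rho>. map_pmf (Pair \<rho>) (chain_law (cond_marg \<mu>) L \<rho> n))"

lemma history_measurable: "history \<in> coins \<rightarrow>\<^sub>M count_space UNIV"
  and distr_history: "distr coins (count_space UNIV) history = measure_pmf history_law"
  using dist_by_chain[of n n "cond_marg \<mu>" L]
  unfolding dist_by_def history_def[abs_def] history_law_def orders_def by auto

text \<open>Order and chain form a discrete random variable, so measurability of everything computed
  from them is automatic.\<close>

lemma function_of_history_measurable: "(\<lambda>\<omega>. G (history \<omega>)) \<in> coins \<rightarrow>\<^sub>M M" if "\<And>h. G h \<in> space M"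
  by (rule measurable_compose[OF history_measurable]) (use that in auto)

lemma nn_integral_history: "(\<integral>\<^sup>+ \<omega>. G (history \<omega>) \<partial>coins) = (\<integral>\<^sup>+ h. G h \<partial>history_law)"
  by (subst distr_history[symmetric], subst nn_integral_distr[OF history_measurable]) auto

lemma num_rounds_eq: "rounds \<omega> = of_nat (num_steps L n (mismatch (snd (history \<omega>))))"
  using num_rounds_block_sampler[where len=block_length, OF block_length_pos] by (simp add: history_def)

lemma num_queries_eq: "num_queries alg n q (cond_marg \<mu>) \<omega> =
    (\<Sum>k<num_steps L n (mismatch (snd (history \<omega>))). of_nat (card (round_queries L n (fst (history \<omega>)) (snd (history \<omega>)) k)))"
  using num_queries_block_sampler[where len=block_length, OF block_length_pos] by (simp add: history_def)

lemma alg_output_eq: "alg_output alg n q (cond_marg \<mu>) \<omega> = Some (assemble n (fst (history \<omega>)) (map fst (snd (history \<omega>))))"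
  using alg_output_block_sampler[where len=block_length, OF block_length_pos] by (simp add: history_def)

lemma num_rounds_measurable: "rounds \<in> borel_measurable coins"
  unfolding num_rounds_eq[abs_def] by (rule function_of_history_measurable) simp

lemma num_queries_measurable: "num_queries alg n q (cond_marg \<mu>) \<in> borel_measurable coins"
  unfolding num_queries_eq[abs_def] by (rule function_of_history_measurable) simp

text \<open>Outside \<open>{1..n}\<close> both sides are \<open>undefined\<close>:
  \<open>assemble\<close> restricts, and the support consists of extensional functions.\<close>

lemma assemble_map:
  assumes "\<rho> \<in> orders" "x \<in> set_pmf \<mu>"
  shows "assemble n \<rho> (map x (take n \<rho>)) = x"
proof
  fix i
  have "take n \<rho> = \<rho>" "set \<rho> = {1..n}" using ordersD[OF assms(1)] by auto
  then show "assemble n \<rho> (map x (take n \<rho>)) i = x i"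
    using assignment_map[of i n \<rho> x] supp assms(2)
    by (cases "i \<in> {1..n}") (auto simp: assemble_def PiE_def extensional_def)
qed

lemma output_law: "map_pmf (\<lambda>(\<rho>, zs). assemble n \<rho> (map fst zs)) history_law = \<mu>"
proof -
  have "map_pmf (\<lambda>(\<rho>, zs). assemble n \<rho> (map fst zs)) history_law
      = bind_pmf (pmf_of_set orders) (\<lambda>\<rho>. map_pmf (assemble n \<rho>) (map_pmf (map fst) (chain_law (cond_marg \<mu>) L \<rho> n)))"
    by (simp add: history_law_def map_bind_pmf pmf.map_comp comp_def)
  also have "\<dots> = bind_pmf (pmf_of_set orders) (\<lambda>\<rho>. \<mu>)"
  proof (rule bind_pmf_cong[OF refl])
    fix \<rho> assume "\<rho> \<in> set_pmf (pmf_of_set orders)"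
    then have \<rho>: "\<rho> \<in> orders" by (simp add: set_pmf_of_set[OF orders_nonempty finite_orders])
    have "map_pmf (assemble n \<rho>) (map_pmf (map fst) (chain_law (cond_marg \<mu>) L \<rho> n)) = map_pmf (\<lambda>x. assemble n \<rho> (map x (take n \<rho>))) \<mu>"
      by (simp add: map_fst_chain_law[OF \<rho>] pmf.map_comp comp_def)
    also have "\<dots> = map_pmf (\<lambda>x. x) \<mu>"
      by (intro map_pmf_cong refl assemble_map \<rho>)
    finally show "map_pmf (assemble n \<rho>) (map_pmf (map fst) (chain_law (cond_marg \<mu>) L \<rho> n)) = \<mu>" by simp
  qed
  finally show ?thesis by simp
qed

lemma alg_output_law:
  "{\<omega> \<in> space coins. alg_output alg n q (cond_marg \<mu>) \<omega> = Some x} \<in> sets coins"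
  "measure coins {\<omega> \<in> space coins. alg_output alg n q (cond_marg \<mu>) \<omega> = Some x} = pmf \<mu> x"
proof -
  let ?A = "(\<lambda>(\<rho>, zs). assemble n \<rho> (map fst zs)) -` {x}"
  have e: "{\<omega> \<in> space coins. alg_output alg n q (cond_marg \<mu>) \<omega> = Some x} = history -` ?A \<inter> space coins"
    by (auto simp: alg_output_eq split: prod.splits)
  show "{\<omega> \<in> space coins. alg_output alg n q (cond_marg \<mu>) \<omega> = Some x} \<in> sets coins"
    unfolding e by (rule measurable_sets[OF history_measurable]) simp
  have "measure coins (history -` ?A \<inter> space coins) = measure (distr coins (count_space UNIV) history) ?A"
    by (rule measure_distr[OF history_measurable, symmetric]) simp
  also have "\<dots> = pmf (map_pmf (\<lambda>(\<rho>, zs). assemble n \<rho> (map fst zs)) history_law) x"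
    by (simp only: distr_history pmf_map)
  also have "\<dots> = pmf \<mu> x" by (simp only: output_law)
  finally show "measure coins {\<omega> \<in> space coins. alg_output alg n q (cond_marg \<mu>) \<omega> = Some x} = pmf \<mu> x"
    unfolding e .
qed

lemma length_history: "length (snd (history \<omega>)) = n"
  by (simp add: history_def)

lemma expected_mistakes_bounds:
  "(\<integral>\<^sup>+ \<omega>. of_nat (mistakes (snd (history \<omega>))) \<partial>coins) \<le> ennreal (real n)"
  "(\<integral>\<^sup>+ \<omega>. of_nat (mistakes (snd (history \<omega>))) \<partial>coins) \<le> ennreal (4 * real n / real L + (real L)\<^sup>2 * ln (real q) / 4)"
proof -
  have "mistakes (snd (history \<omega>)) \<le> n" for \<omega>
    unfolding mistakes_def using length_filter_le[of _ "snd (history \<omega>)"] by (simp add: length_history)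
  then have "(\<integral>\<^sup>+ \<omega>. of_nat (mistakes (snd (history \<omega>))) \<partial>coins) \<le> (\<integral>\<^sup>+ \<omega>. of_nat n \<partial>coins)"
    by (intro nn_integral_mono) simp
  then show "(\<integral>\<^sup>+ \<omega>. of_nat (mistakes (snd (history \<omega>))) \<partial>coins) \<le> ennreal (real n)"
    using coins.emeasure_space_1 by (simp add: ennreal_of_nat_eq_real_of_nat)
  have "(\<integral>\<^sup>+ \<omega>. of_nat (mistakes (snd (history \<omega>))) \<partial>coins) = (\<integral>\<^sup>+ (\<rho>, zs). of_nat (mistakes zs) \<partial>history_law)"
    by (subst nn_integral_history[of "\<lambda>h. of_nat (mistakes (snd h))"]) (simp add: case_prod_beta')
  \<comment> \<open>\<epsilon> is \<open>1 / L\<close>, so that the first term is of the order of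
    the number of blocks.\<close>
  also have "\<dots> \<le> ennreal (4 * (1 / real L) * real n + real L * ln (real q) / (4 * (1 / real L)))"
    unfolding history_law_def using n2 q2 block_length_pos by (intro expected_mistakes_le) auto
  also have "4 * (1 / real L) * real n + real L * ln (real q) / (4 * (1 / real L)) = 4 * real n / real L + (real L)\<^sup>2 * ln (real q) / 4"
    by (simp add: power2_eq_square)
  finally show "(\<integral>\<^sup>+ \<omega>. of_nat (mistakes (snd (history \<omega>))) \<partial>coins) \<le> ennreal (4 * real n / real L + (real L)\<^sup>2 * ln (real q) / 4)" .
qed

lemma rounds_le: "rounds \<omega> \<le> of_nat (mistakes (snd (history \<omega>))) + ennreal (2 * (real n / real L + 1))"
proof -
  have "rounds \<omega> \<le> of_nat (mistakes (snd (history \<omega>)) + 2 * Suc (n div L))"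
    unfolding num_rounds_eq using num_steps_le[OF block_length_pos[of n q], of n "mismatch (snd (history \<omega>))"] bad_from_mismatch[of "snd (history \<omega>)"]
    by (simp only: length_history of_nat_le_iff)
  also have "\<dots> = of_nat (mistakes (snd (history \<omega>))) + ennreal (real (2 * Suc (n div L)))"
    by (simp only: of_nat_add ennreal_of_nat_eq_real_of_nat[symmetric])
  also have "\<dots> \<le> of_nat (mistakes (snd (history \<omega>))) + ennreal (2 * (real n / real L + 1))"
    by (intro add_left_mono ennreal_leI) (use of_nat_div_le_of_nat[where 'a=real, of n L] in simp)
  finally show ?thesis .
qed

lemma queries_le: "num_queries alg n q (cond_marg \<mu>) \<omega> \<le> of_nat L * rounds \<omega>"
proof -
  have "num_queries alg n q (cond_marg \<mu>) \<omega> \<le> (\<Sum>k<num_steps L n (mismatch (snd (history \<omega>))). of_nat L)"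
    unfolding num_queries_eq using card_round_queries[OF block_length_pos] by (intro sum_mono) simp
  then show ?thesis by (simp add: num_rounds_eq mult.commute)
qed

lemma expected_costs:
  "(\<integral>\<^sup>+ \<omega>. num_queries alg n q (cond_marg \<mu>) \<omega> \<partial>coins) \<le> ennreal (11 * real n)"
  "(\<integral>\<^sup>+ \<omega>. rounds \<omega> \<partial>coins) \<le> ennreal (17 * (real n powr (2/3) * ln (real q) powr (1/3)))"
proof -
  obtain m where m: "m \<in> {real n, 4 * real n / real L + (real L)\<^sup>2 * ln (real q) / 4}"
    and r: "m + 2 * (real n / real L + 1) \<le> 17 * (real n powr (2/3) * ln (real q) powr (1/3))"
    and c: "real L * (m + 2 * (real n / real L + 1)) \<le> 11 * real n"
    using block_length_tradeoff[OF n2 q2] by blast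
  have m0: "0 \<le> m" using m q2 by auto
  have "(\<integral>\<^sup>+ \<omega>. rounds \<omega> \<partial>coins) \<le> (\<integral>\<^sup>+ \<omega>. of_nat (mistakes (snd (history \<omega>))) + ennreal (2 * (real n / real L + 1)) \<partial>coins)"
    by (intro nn_integral_mono rounds_le)
  also have "\<dots> = (\<integral>\<^sup>+ \<omega>. of_nat (mistakes (snd (history \<omega>))) \<partial>coins) + ennreal (2 * (real n / real L + 1))"
    using coins.emeasure_space_1
    by (subst nn_integral_add) (auto intro!: function_of_history_measurable[of "\<lambda>h. of_nat (mistakes (snd h))"])
  also have "\<dots> \<le> ennreal m + ennreal (2 * (real n / real L + 1))"
    using m expected_mistakes_bounds by (intro add_right_mono) auto
  also have "\<dots> = ennreal (m + 2 * (real n / real L + 1))"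
    using m0 by (intro ennreal_plus[symmetric]) auto
  finally have R: "(\<integral>\<^sup>+ \<omega>. rounds \<omega> \<partial>coins) \<le> ennreal (m + 2 * (real n / real L + 1))" .
  then show "(\<integral>\<^sup>+ \<omega>. rounds \<omega> \<partial>coins) \<le> ennreal (17 * (real n powr (2/3) * ln (real q) powr (1/3)))"
    using r by (rule order_trans[OF _ ennreal_leI])
  have "(\<integral>\<^sup>+ \<omega>. num_queries alg n q (cond_marg \<mu>) \<omega> \<partial>coins) \<le> (\<integral>\<^sup>+ \<omega>. of_nat L * rounds \<omega> \<partial>coins)"
    by (intro nn_integral_mono queries_le)
  also have "\<dots> = of_nat L * (\<integral>\<^sup>+ \<omega>. rounds \<omega> \<partial>coins)"
    by (rule nn_integral_cmult[OF num_rounds_measurable])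
  also have "\<dots> \<le> of_nat L * ennreal (m + 2 * (real n / real L + 1))"
    by (rule mult_left_mono[OF R]) simp
  also have "\<dots> = ennreal (real L * (m + 2 * (real n / real L + 1)))"
    using m0 by (simp only: ennreal_of_nat_eq_real_of_nat) (rule ennreal_mult[symmetric], auto)
  also have "\<dots> \<le> ennreal (11 * real n)" by (rule ennreal_leI[OF c])
  finally show "(\<integral>\<^sup>+ \<omega>. num_queries alg n q (cond_marg \<mu>) \<omega> \<partial>coins) \<le> ennreal (11 * real n)" .
qed

end

theorem theorem1p1:
  shows "\<exists>(A::algorithm) (C::real). C > 0 \<and>
    (\<forall>n q (\<mu>::(nat \<Rightarrow> nat) pmf). n \<ge> 2 \<longrightarrow> q \<ge> 2 \<longrightarrow>
       set_pmf \<mu> \<subseteq> PiE {1..n} (\<lambda>_. {1..q}) \<longrightarrow>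
       (\<forall>x. {\<omega> \<in> space coins. alg_output A n q (cond_marg \<mu>) \<omega> = Some x} \<in> sets coins \<and>
            measure coins {\<omega> \<in> space coins. alg_output A n q (cond_marg \<mu>) \<omega> = Some x} = pmf \<mu> x)
     \<and> num_queries A n q (cond_marg \<mu>) \<in> borel_measurable coins
     \<and> num_rounds A n q (cond_marg \<mu>) \<in> borel_measurable coins
     \<and> (\<integral>\<^sup>+ \<omega>. num_queries A n q (cond_marg \<mu>) \<omega> \<partial>coins) \<le> ennreal (C * real n)
     \<and> (\<integral>\<^sup>+ \<omega>. num_rounds A n q (cond_marg \<mu>) \<omega> \<partial>coins)
         \<le> ennreal (C * real n powr (2/3) *
              min (ln (real n) powr (2/3) * ln (real q))
                  (real q powr (1/3) * ln (real q) powr (1/3))))"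
\<comment> \<open>68 is 17 from \<open>expected_costs\<close> times 4 from
  \<open>rounds_target\<close>; it also covers the 11 for the queries.\<close>
proof (intro exI[of _ "block_sampler block_length"] exI[of _ "68::real"] conjI allI impI)
  fix n q :: nat and \<mu> :: "(nat \<Rightarrow> nat) pmf"
  assume n: "2 \<le> n" and q: "2 \<le> q" and supp: "set_pmf \<mu> \<subseteq> PiE {1..n} (\<lambda>_. {1..q})"
  interpret sampling_run \<mu> n q by unfold_locales (use n q supp in auto)
  show "{\<omega> \<in> space coins. alg_output alg n q (cond_marg \<mu>) \<omega> = Some x} \<in> sets coins" for x
    by (rule alg_output_law)
  show "measure coins {\<omega> \<in> space coins. alg_output alg n q (cond_marg \<mu>) \<omega> = Some x} = pmf \<mu> x" for x
    by (rule alg_output_law)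
  show "num_queries alg n q (cond_marg \<mu>) \<in> borel_measurable coins"
    by (rule num_queries_measurable)
  show "num_rounds alg n q (cond_marg \<mu>) \<in> borel_measurable coins"
    by (rule num_rounds_measurable)
  show "(\<integral>\<^sup>+ \<omega>. num_queries alg n q (cond_marg \<mu>) \<omega> \<partial>coins) \<le> ennreal (68 * real n)"
    by (rule order_trans[OF expected_costs(1)], rule ennreal_leI) simp
  show "(\<integral>\<^sup>+ \<omega>. num_rounds alg n q (cond_marg \<mu>) \<omega> \<partial>coins)
         \<le> ennreal (68 * real n powr (2/3) *
              min (ln (real n) powr (2/3) * ln (real q))
                  (real q powr (1/3) * ln (real q) powr (1/3)))"
    using mult_left_mono[OF rounds_target[OF n q], of 17]
    by (intro order_trans[OF expected_costs(2)] ennreal_leI) (simp add: mult.assoc)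
qed simp

end
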